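(* Let $\varepsilon=\varepsilon_A$ on $(-\infty,x_0)$ and $\varepsilon=\varepsilon_B$ on $[x_0,\infty)$, where $\varepsilon_A,\varepsilon_B$ are complex-valued permittivities as in the context. Let $u$ be a localised eigenmode of $-\frac{1}{\mu_0}\left(\frac{1}{\varepsilon}u'\right)'=\omega^2u$ on $\mathbb{R}$ with associated eigenfrequency $\omega\in\mathbb{C}$. Then $$u(x_n)=O\big(|\lambda_1^{(A)}(\omega)|^{|n|}\big)\ \text{ and }\ u'(x_n)=O\big(|\lambda_1^{(A)}(\omega)|^{|n|}\big)\quad\text{as }n\to-\infty,$$ $$u(x_n)=O\big(|\lambda_1^{(B)}(\omega)|^{|n|}\big)\ \text{ and }\ u'(x_n)=O\big(|\lambda_1^{(B)}(\omega)|^{|n|}\big)\quad\text{as }n\to+\infty,$$ where, for $j=A,B$, $\lambda_1^{(j)}(\omega)$ is the eigenvalue of the transfer matrix $T_p^{(j)}(\omega)$ satisfying $|\lambda_1^{(j)}(\omega)|<1$.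
   Context: Fix a real constant $\mu_0>0$ and a point $x_0\in\mathbb{R}$, and put $x_n=x_0+n$ for $n\in\mathbb{Z}$. For $j\in\{A,B\}$, $\varepsilon_j:\mathbb{R}\to\mathbb{C}$ is piecewise smooth (finitely many breakpoints per period, with one-sided limits), has $\mathrm{Re}(\varepsilon_j)>0$ (also for one-sided limits), is $1$-periodic, and is inversion symmetric: $\varepsilon_j(x_0+h)=\varepsilon_j(x_0+1-h)$ for $h\in(0,1)$. Put $\mathcal{L}_ju=-\frac{1}{\mu_0}\left(\frac{1}{\varepsilon_j}u'\right)'$. Solutions of the differential equations are understood with $u$ and $\frac{1}{\varepsilon}u'$ (resp. $\frac{1}{\varepsilon_j}u'$) continuous. The transfer matrix $T_p^{(j)}(\omega)$ is the $2\times2$ matrix propagating solutions of $\mathcal{L}_ju=\omega^2u$ across one unit cell: $(u(x_{n+1}),u'(x_{n+1}))^\top=T_p^{(j)}(\omega)(u(x_n),u'(x_n))^\top$ for every solution $u$ and every $n\in\mathbb{Z}$. A localised eigenmode is a nonzero solution $u$ which decays exponentially, together with its derivative, as $|x|\to\infty$; its eigenfrequency $\omega$ lies in a common band gap, i.e. for neither $j=A$ nor $j=B$ does $\mathcal{L}_jv=\omega^2v$ have a nonzero solution $v$ on $\mathbb{R}$ with $v(x+1)=e^{i\kappa}v(x)$, $v'(x+1)=e^{i\kappa}v'(x)$ for some $\kappa\in[-\pi,\pi]$; for such $\omega$ each $T_p^{(j)}(\omega)$ has exactly one eigenvalue of modulus less than $1$. *)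

theory Defs
  imports "HOL-Analysis.Analysis" "HOL-Library.Landau_Symbols"
begin

text \<open>\<open>C\<^sup>\<infinity>\<close> on a set \<open>U\<close>, meant for open \<open>U\<close>; \<open>D k\<close> is the \<open>k\<close>-th derivative.\<close>

definition smooth_on :: "real set \<Rightarrow> (real \<Rightarrow> complex) \<Rightarrow> bool" where
  "smooth_on U f \<longleftrightarrow>
     (\<exists>D :: nat \<Rightarrow> real \<Rightarrow> complex. D 0 = f \<and>
        (\<forall>k. \<forall>x\<in>U. (D k has_vector_derivative D (Suc k) x) (at x)))"

text \<open>The set \<open>S\<close> of breakpoints is locally finite, hence closed, so \<open>- S\<close> is open.
  The values of \<open>f\<close> at the breakpoints are not tied to the one-sided limits.\<close>

definition piecewise_smooth :: "(real \<Rightarrow> complex) \<Rightarrow> bool" where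
  "piecewise_smooth f \<longleftrightarrow>
     (\<exists>S. (\<forall>a. finite (S \<inter> {a..a + 1})) \<and> smooth_on (- S) f) \<and>
     (\<forall>x. (\<exists>l. (f \<longlongrightarrow> l) (at_left x)) \<and> (\<exists>l. (f \<longlongrightarrow> l) (at_right x)))"

definition permittivity :: "real \<Rightarrow> (real \<Rightarrow> complex) \<Rightarrow> bool" where
  "permittivity x\<^sub>0 \<epsilon> \<longleftrightarrow>
     piecewise_smooth \<epsilon> \<and>
     (\<forall>x. Re (\<epsilon> x) > 0) \<and>
     (\<forall>x l. (\<epsilon> \<longlongrightarrow> l) (at_left x) \<or> (\<epsilon> \<longlongrightarrow> l) (at_right x) \<longrightarrow> Re l > 0) \<and>
     (\<forall>x. \<epsilon> (x + 1) = \<epsilon> x) \<and>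
     (\<forall>h\<in>{0<..<1}. \<epsilon> (x\<^sub>0 + h) = \<epsilon> (x\<^sub>0 + 1 - h))"

text \<open>\<open>u\<close> solves \<open>- 1/\<mu> ((1/\<epsilon>) u')' = \<omega>\<^sup>2 u\<close> on the whole line, where \<open>u\<close> and the flux
  \<open>w = (1/\<epsilon>) u'\<close> are continuous everywhere.  The equation itself is imposed away from the
  discontinuities of \<open>\<epsilon>\<close>, where \<open>u'\<close> need not exist.\<close>

definition solution :: "real \<Rightarrow> (real \<Rightarrow> complex) \<Rightarrow> complex \<Rightarrow> (real \<Rightarrow> complex) \<Rightarrow> bool" where
  "solution \<mu> \<epsilon> \<omega> u \<longleftrightarrow>
     continuous_on UNIV u \<and>
     (\<exists>w. continuous_on UNIV w \<and>
        (\<forall>x. isCont \<epsilon> x \<longrightarrow>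
           (\<exists>u' w'. (u has_vector_derivative u') (at x) \<and> w x = (1 / \<epsilon> x) * u' \<and>
              (w has_vector_derivative w') (at x) \<and>
              - (1 / of_real \<mu>) * w' = \<omega>\<^sup>2 * u x)))"

text \<open>The vector \<open>(u(x\<^sub>n), u'(x\<^sub>n))\<close> with \<open>x\<^sub>n = x\<^sub>0 + n\<close>.  For a single medium, periodicity and
  inversion symmetry make the two one-sided limits of \<open>\<epsilon>\<close> at \<open>x\<^sub>n\<close> equal, so every solution is
  differentiable at \<open>x\<^sub>n\<close> even if \<open>x\<^sub>n\<close> is a breakpoint.\<close>

definition cauchy_data :: "real \<Rightarrow> (real \<Rightarrow> complex) \<Rightarrow> int \<Rightarrow> complex^2" where
  "cauchy_data x\<^sub>0 u n =
     vector [u (x\<^sub>0 + of_int n), vector_derivative u (at (x\<^sub>0 + of_int n))]"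

definition transfer_matrix ::
    "real \<Rightarrow> real \<Rightarrow> (real \<Rightarrow> complex) \<Rightarrow> complex \<Rightarrow> complex^2^2" where
  "transfer_matrix \<mu> x\<^sub>0 \<epsilon> \<omega> =
     (THE T. \<forall>u. solution \<mu> \<epsilon> \<omega> u \<longrightarrow>
        (\<forall>n. cauchy_data x\<^sub>0 u (n + 1) = T *v cauchy_data x\<^sub>0 u n))"

definition eigenvalue :: "complex^2^2 \<Rightarrow> complex \<Rightarrow> bool" where
  "eigenvalue T c \<longleftrightarrow> (\<exists>v. v \<noteq> 0 \<and> T *v v = c *s v)"

text \<open>Well defined for \<open>\<omega>\<close> in a band gap: the transfer matrix then has exactly one eigenvalue of
  modulus less than one.\<close>

definition lambda1 :: "real \<Rightarrow> real \<Rightarrow> (real \<Rightarrow> complex) \<Rightarrow> complex \<Rightarrow> complex" where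
  "lambda1 \<mu> x\<^sub>0 \<epsilon> \<omega> =
     (THE c. eigenvalue (transfer_matrix \<mu> x\<^sub>0 \<epsilon> \<omega>) c \<and> norm c < 1)"

text \<open>The condition \<open>v'(x + 1) = e\<^sup>i\<^sup>\<kappa> v'(x)\<close> is imposed wherever \<open>v'(x)\<close> exists.\<close>

definition in_band_gap :: "real \<Rightarrow> (real \<Rightarrow> complex) \<Rightarrow> complex \<Rightarrow> bool" where
  "in_band_gap \<mu> \<epsilon> \<omega> \<longleftrightarrow>
     \<not> (\<exists>v. \<exists>\<kappa>\<in>{- pi..pi}. solution \<mu> \<epsilon> \<omega> v \<and> (\<exists>x. v x \<noteq> 0) \<and>
          (\<forall>x. v (x + 1) = exp (\<i> * of_real \<kappa>) * v x) \<and>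
          (\<forall>x d. (v has_vector_derivative d) (at x) \<longrightarrow>
             (v has_vector_derivative exp (\<i> * of_real \<kappa>) * d) (at (x + 1))))"

definition interface :: "real \<Rightarrow> (real \<Rightarrow> complex) \<Rightarrow> (real \<Rightarrow> complex) \<Rightarrow> real \<Rightarrow> complex" where
  "interface x\<^sub>0 \<epsilon>A \<epsilon>B x = (if x < x\<^sub>0 then \<epsilon>A x else \<epsilon>B x)"

text \<open>Exponential decay of \<open>u'\<close> is required wherever \<open>u'\<close> exists, that is, at all points except
  jumps of \<open>\<epsilon>\<close>; the one-sided derivatives at a jump are limits of these values.\<close>

definition localised_eigenmode ::
    "real \<Rightarrow> (real \<Rightarrow> complex) \<Rightarrow> complex \<Rightarrow> (real \<Rightarrow> complex) \<Rightarrow> bool" where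
  "localised_eigenmode \<mu> \<epsilon> \<omega> u \<longleftrightarrow>
     solution \<mu> \<epsilon> \<omega> u \<and> (\<exists>x. u x \<noteq> 0) \<and>
     (\<exists>C a. a > 0 \<and>
        (\<forall>\<^sub>F x in at_infinity.
           norm (u x) \<le> C * exp (- a * \<bar>x\<bar>) \<and>
           (\<forall>d. (u has_vector_derivative d) (at x) \<longrightarrow> norm d \<le> C * exp (- a * \<bar>x\<bar>))))"

end

theory Submission
  imports Defs
begin

text \<open>On each half-line, \<open>u\<close> coincides with a solution for the periodic medium there, whose vector
  \<open>c n\<close> of Cauchy data at \<open>x\<^sub>n\<close> satisfies \<open>c (n + 1) = T c n\<close>.  The Wronskian gives \<open>det T = 1\<close>, and an
  eigenvalue of modulus one would yield a Bloch wave, so in a band gap the eigenvalues are \<open>q\<close> and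
  \<open>1 / q\<close> with \<open>\<bar>q\<bar> < 1\<close>.  As \<open>c\<close> decays, it has no component along the growing eigendirection,
  hence \<open>c n = q ^ n c 0\<close>.  Existence of \<open>T\<close> rests on solving the differential equation for a
  piecewise continuous coefficient.\<close>

subsection \<open>Antiderivatives and linear differential equations\<close>

text \<open>The obstacle is that \<open>\<epsilon>\<close> may jump and the derivative of a solution
  with it. The analysis therefore uses the pair of the field \<open>u\<close> and the flux
  \<open>w\<close>, the quotient of \<open>u'\<close> by \<open>\<epsilon>\<close>, both continuous.
  The Wronskian \<open>u * z - w * v\<close> of two such pairs involves no derivative of
  \<open>\<epsilon>\<close>, has derivative zero off a locally finite set and is continuous, hence
  constant; it also takes the place of a Gronwall estimate in the proof of uniqueness. The
  derivative itself returns only at the nodes \<open>x\<^sub>n\<close>, where inversion symmetry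
  makes the one-sided limits of \<open>\<epsilon>\<close> equal. Since
  \<open>transfer_matrix\<close> and \<open>lambda1\<close> are definite descriptions, they must be
  shown to denote: solutions with arbitrary data at \<open>x\<^sub>0\<close> determine
  \<open>T\<close>, and the band gap singles out \<open>q\<close>. The interface node needs care:
  \<open>u\<close> may have no derivative there, so the constants in the estimates come from the
  data at \<open>x\<^sub>0\<close> of the continued periodic solutions rather than from
  \<open>u\<close>.\<close>

lemma bounded_image_if_one_sided_limits:
  fixes f :: "real \<Rightarrow> 'a::real_normed_vector"
  assumes left: "\<And>x. \<exists>l. (f \<longlongrightarrow> l) (at_left x)"
    and right: "\<And>x. \<exists>l. (f \<longlongrightarrow> l) (at_right x)"
  shows "bounded (f ` {a..b})"
proof (cases "a \<le> b")
  case True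
  then show ?thesis
  proof (induction rule: Bolzano)
    case (trans a b c)
    then have "{a..c} = {a..b} \<union> {b..c}" by auto
    with trans show ?case by (simp add: image_Un)
  next
    \<comment> \<open>Near \<open>x\<close> the two one-sided limits bound \<open>f\<close>; the
      value \<open>f x\<close> is tied to neither of them and enters the bound separately.\<close>
    case (local x)
    obtain l r where l: "(f \<longlongrightarrow> l) (at_left x)" and r: "(f \<longlongrightarrow> r) (at_right x)"
      using left right by blast
    have "eventually (\<lambda>y. norm (f y) < norm l + 1) (at_left x)"
      using order_tendstoD(2)[OF tendsto_norm[OF l]] by simp
    then obtain d1 where d1: "d1 < x" "\<And>y. d1 < y \<Longrightarrow> y < x \<Longrightarrow> norm (f y) < norm l + 1"
      by (auto simp: eventually_at_left_field)
    have "eventually (\<lambda>y. norm (f y) < norm r + 1) (at_right x)"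
      using order_tendstoD(2)[OF tendsto_norm[OF r]] by simp
    then obtain d2 where d2: "x < d2" "\<And>y. x < y \<Longrightarrow> y < d2 \<Longrightarrow> norm (f y) < norm r + 1"
      by (auto simp: eventually_at_right_field)
    have "bounded (f ` {a..b})" if ab: "a \<le> x \<and> x \<le> b \<and> b - a < min (x - d1) (d2 - x)" for a b
    proof -
      have "norm (f y) \<le> norm l + norm r + norm (f x) + 1" if "y \<in> {a..b}" for y
      proof (cases y x rule: linorder_cases)
        case less
        with ab that have "norm (f y) < norm l + 1" by (intro d1) auto
        then show ?thesis by (smt (verit) norm_ge_zero)
      next
        case greater
        with ab that have "norm (f y) < norm r + 1" by (intro d2) auto
        then show ?thesis by (smt (verit) norm_ge_zero)
      qed (use norm_ge_zero[of l] norm_ge_zero[of r] in simp)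
      then show ?thesis unfolding bounded_iff by blast
    qed
    then show ?case using d1(1) d2(1)
      by (intro exI[of _ "min (x - d1) (d2 - x)"]) auto
  qed
qed simp

text \<open>Off finitely many points \<open>f\<close> is continuous, hence measurable, and dominated
  by a constant; the deleted points are negligible.\<close>

lemma integrable_bounded_finite_discontinuities:
  fixes f :: "real \<Rightarrow> 'a::euclidean_space"
  assumes bdd: "bounded (f ` {a..b})" and fin: "finite (K \<inter> {a..b})"
    and cont: "\<And>x. x \<in> {a..b} - K \<Longrightarrow> isCont f x"
  shows "f integrable_on {a..b}"
proof -
  define S where "S = {a..b} - (K \<inter> {a..b})"
  have S: "S \<in> sets lebesgue"
    unfolding S_def using fin by (intro sets.Diff) (auto intro: negligible_imp_sets negligible_finite)
  obtain B where "\<forall>y\<in>f ` {a..b}. norm y \<le> B"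
    using bdd[unfolded bounded_iff] ..
  then have B: "norm (f x) \<le> B" if "x \<in> {a..b}" for x
    using that by blast
  have diff: "negligible ({a..b} - S \<union> (S - {a..b}))"
    by (rule negligible_subset[OF negligible_finite[OF fin]]) (auto simp: S_def)
  have "continuous_on S f"
    using cont by (intro continuous_at_imp_continuous_on ballI) (auto simp: S_def)
  then have "f \<in> borel_measurable (lebesgue_on S)"
    using S by (rule continuous_imp_measurable_on_sets_lebesgue)
  moreover have B_int: "(\<lambda>_. B) integrable_on S"
    using integrable_spike_set_eq[of "{a..b}" S "\<lambda>_. B"] diff by (auto simp: S_def)
  ultimately have "f integrable_on S"
    using B S by (intro measurable_bounded_by_integrable_imp_integrable[OF _ B_int]) (auto simp: S_def)
  then show ?thesis
    using diff integrable_spike_set_eq[of "{a..b}" S f] by (auto simp: S_def)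
qed

lemma antiderivative_exists:
  fixes f :: "real \<Rightarrow> 'a::banach"
  assumes f: "\<And>a b. f integrable_on {a..b}"
  obtains F where "F t0 = 0" and "continuous_on UNIV F"
    and "\<And>t. isCont f t \<Longrightarrow> (F has_vector_derivative f t) (at t)"
proof -
  \<comment> \<open>At most one of the two integrals is over a nondegenerate interval, so
    \<open>F\<close> is the oriented integral from \<open>t0\<close>. Moving the base point to some
    \<open>a\<close> left of both \<open>t\<close> and \<open>t0\<close> changes it by a constant
    and puts \<open>t\<close> in the interior.\<close>
  define F where "F t = integral {t0..t} f - integral {t..t0} f" for t
  have shift: "F t = integral {a..t} f - integral {a..t0} f" if "a \<le> t" "a \<le> t0" for a t
  proof (cases "t0 \<le> t")
    case True
    then show ?thesis
      using Henstock_Kurzweil_Integration.integral_combine[OF that(2) True f] by (cases "t = t0") (auto simp: F_def algebra_simps)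
  next
    case False
    then show ?thesis
      using Henstock_Kurzweil_Integration.integral_combine[OF that(1) _ f, of t0] by (auto simp: F_def algebra_simps)
  qed
  have der: "(F has_vector_derivative f t) (at t)" if "isCont f t" for t
  proof -
    define a b where "a = min t t0 - 1" and "b = t + 1"
    have "((\<lambda>u. integral {a..u} f) has_vector_derivative f t) (at t within {a..b} - {})"
      using that by (intro integral_has_vector_derivative_continuous_at f)
        (auto simp: a_def b_def intro: continuous_at_imp_continuous_within)
    then have "((\<lambda>u. integral {a..u} f) has_vector_derivative f t) (at t)"
      by (simp add: a_def b_def at_within_Icc_at)
    then have "((\<lambda>u. integral {a..u} f - integral {a..t0} f) has_vector_derivative f t) (at t)"
      by (auto intro!: derivative_eq_intros)
    then show ?thesis
      by (rule has_vector_derivative_transform_within_open[where S = "{a<..}"])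
        (use shift[of a] in \<open>auto simp: a_def\<close>)
  qed
  have "isCont F t" for t
  proof -
    define a b where "a = min t t0 - 1" and "b = t + 1"
    have "continuous_on {a..b} (\<lambda>u. integral {a..u} f - integral {a..t0} f)"
      by (intro continuous_intros indefinite_integral_continuous_1 f)
    then have "continuous_on {a..b} F"
      by (rule continuous_on_eq) (use shift[of a] in \<open>auto simp: a_def\<close>)
    then show ?thesis
      by (auto simp: a_def b_def intro!: continuous_on_interior)
  qed
  then show ?thesis
    using that[of F] der by (simp add: F_def[of t0] continuous_on_eq_continuous_at)
qed

text \<open>Mean value inequality along the two rays leaving \<open>t0\<close>, parametrised by the
  distance \<open>s\<close> with direction \<open>c\<close> equal to 1 or -1; the Picard estimate is
  needed on both sides of \<open>t0\<close>.\<close>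

lemma norm_le_from_derivative_bound:
  fixes f :: "real \<Rightarrow> 'a::real_normed_vector"
  assumes f: "\<And>t. (f has_vector_derivative f' t) (at t)" and f0: "f t0 = 0"
    and g: "\<And>s. (g has_vector_derivative g' s) (at s)" and g0: "g 0 = 0"
    and bnd: "\<And>t. \<bar>t - t0\<bar> < R \<Longrightarrow> norm (f' t) \<le> g' \<bar>t - t0\<bar>"
    and t: "\<bar>t - t0\<bar> < R"
  shows "norm (f t) \<le> g \<bar>t - t0\<bar>"
proof -
  have *: "norm (f (t0 + c * s)) \<le> g s" if c: "\<bar>c\<bar> = 1" and s: "0 < s" "s < R" for c s
  proof -
    have "norm (f (t0 + c * s) - f (t0 + c * 0)) \<le> g s - g 0"
    proof (rule differentiable_bound_general[OF s(1), where f = "\<lambda>s. f (t0 + c * s)" and \<phi> = g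
          and \<phi>' = g' and f' = "\<lambda>s. c *\<^sub>R f' (t0 + c * s)"])
      have d: "((\<lambda>s. f (t0 + c * s)) has_vector_derivative c *\<^sub>R f' (t0 + c * x)) (at x)" for x
      proof -
        have "((\<lambda>s. t0 + c * s) has_vector_derivative c) (at x)"
          by (auto intro!: derivative_eq_intros)
        from vector_diff_chain_at[OF this f] show ?thesis by (simp add: o_def)
      qed
      show "((\<lambda>s. f (t0 + c * s)) has_vector_derivative c *\<^sub>R f' (t0 + c * x)) (at x)" for x
        by (rule d)
      show "continuous_on {0..s} (\<lambda>s. f (t0 + c * s))"
        by (intro continuous_at_imp_continuous_on ballI has_vector_derivative_continuous[OF d])
      show "continuous_on {0..s} g"
        by (intro continuous_at_imp_continuous_on ballI has_vector_derivative_continuous[OF g])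
      show "norm (c *\<^sub>R f' (t0 + c * x)) \<le> g' x" if "0 < x" "x < s" for x
        using bnd[of "t0 + c * x"] c s that by (auto simp: abs_mult)
    qed (rule g)
    then show ?thesis by (simp add: f0 g0)
  qed
  show ?thesis
  proof (cases t t0 rule: linorder_cases)
    case less
    then show ?thesis using *[of "-1" "t0 - t"] t by simp
  next
    case greater
    then show ?thesis using *[of 1 "t - t0"] t by simp
  qed (simp add: f0 g0)
qed

text \<open>Picard iteration: the iterates are the terms of a series dominated by
  \<open>\<Sum>n. norm c * (M * \<bar>t - t0\<bar>) ^ n / fact n\<close>.\<close>

lemma linear_ode_solution_exists:
  fixes A :: "real \<Rightarrow> 'a::banach \<Rightarrow> 'a"
  assumes lin: "\<And>t. bounded_linear (A t)"
    and cont: "\<And>y. continuous_on UNIV y \<Longrightarrow> continuous_on UNIV (\<lambda>t. A t (y t))"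
    and bnd: "\<And>R. \<exists>M. \<forall>t y. \<bar>t - t0\<bar> < R \<longrightarrow> norm (A t y) \<le> M * norm y"
  obtains y where "y t0 = c" and "\<And>t. (y has_vector_derivative A t (y t)) (at t)"
proof -
  define Y where "Y = rec_nat (\<lambda>_. c)
    (\<lambda>n y. SOME F. F t0 = 0 \<and> (\<forall>t. (F has_vector_derivative A t (y t)) (at t)))"
  have antider: "\<exists>F. F t0 = 0 \<and> (\<forall>t. (F has_vector_derivative A t (y t)) (at t))"
    if "continuous_on UNIV y" for y
  proof -
    have c: "continuous_on UNIV (\<lambda>t. A t (y t))" using that by (rule cont)
    then have "(\<lambda>t. A t (y t)) integrable_on {a..b}" for a b
      by (intro integrable_continuous_real continuous_on_subset[OF c]) auto
    from antiderivative_exists[OF this, of t0] show ?thesis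
      using c by (metis continuous_on_eq_continuous_at open_UNIV UNIV_I)
  qed
  have Y0: "Y 0 = (\<lambda>_. c)" by (simp add: Y_def)
  have YSuc: "Y (Suc n) t0 = 0 \<and> (\<forall>t. (Y (Suc n) has_vector_derivative A t (Y n t)) (at t))"
    if "continuous_on UNIV (Y n)" for n
    using someI_ex[OF antider[OF that]] by (simp add: Y_def)
  have Ycont: "continuous_on UNIV (Y n)" for n
  proof (induction n)
    case (Suc n)
    then show ?case
      using YSuc[OF Suc] by (intro continuous_at_imp_continuous_on ballI) (blast intro: has_vector_derivative_continuous)
  qed (simp add: Y0)
  have Yt0: "Y (Suc n) t0 = 0"
    and Yder: "(Y (Suc n) has_vector_derivative A t (Y n t)) (at t)" for n t
    using YSuc[OF Ycont] by auto
  have local_bound: "\<exists>M\<ge>0. (\<forall>t y. \<bar>t - t0\<bar> < R \<longrightarrow> norm (A t y) \<le> M * norm y) \<and>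
     (\<forall>n t. \<bar>t - t0\<bar> < R \<longrightarrow> norm (Y n t) \<le> norm c * (M * R) ^ n / fact n)" for R
  proof -
    obtain M where M: "\<And>t y. \<bar>t - t0\<bar> < R \<Longrightarrow> norm (A t y) \<le> M * norm y"
      using bnd by blast
    \<comment> \<open>\<open>M\<close> may be negative when \<open>R \<le> 0\<close> makes its bound
      vacuous; the power estimates need a nonnegative constant.\<close>
    define N where "N = max M 0"
    have N: "norm (A t y) \<le> N * norm y" if "\<bar>t - t0\<bar> < R" for t y
      using M[OF that, of y] by (smt (verit) N_def max.cobounded1 mult_right_mono norm_ge_zero)
    have N0: "0 \<le> N" by (simp add: N_def)
    have "norm (Y n t) \<le> norm c * (N * \<bar>t - t0\<bar>) ^ n / fact n" if "\<bar>t - t0\<bar> < R" for n t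
      using that
    proof (induction n arbitrary: t)
      case (Suc n)
      show ?case
      proof (rule norm_le_from_derivative_bound[OF Yder Yt0 _ _ _ Suc.prems,
            where g = "\<lambda>s. norm c * (N * s) ^ Suc n / fact (Suc n)" and
              g' = "\<lambda>s. N * (norm c * (N * s) ^ n / fact n)"])
        show "((\<lambda>s. norm c * (N * s) ^ Suc n / fact (Suc n)) has_vector_derivative
            N * (norm c * (N * s) ^ n / fact n)) (at s)" for s
        proof -
          have "((\<lambda>s. N * s) has_real_derivative N) (at s)"
            by (auto intro!: derivative_eq_intros)
          from DERIV_cmult[OF DERIV_power_Suc[OF this], of "norm c / fact (Suc n)" n]
          have "((\<lambda>s. norm c * (N * s) ^ Suc n / fact (Suc n)) has_real_derivative
              norm c / fact (Suc n) * ((1 + real n) * (N * (N * s) ^ n))) (at s)"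
            by (simp only: times_divide_eq_left)
          also have "norm c / fact (Suc n) * ((1 + real n) * (N * (N * s) ^ n)) =
              N * (norm c * (N * s) ^ n / fact n)"
            by (simp add: divide_simps fact_Suc del: of_nat_Suc) (simp add: algebra_simps)?
          finally show ?thesis
            by (simp only: has_real_derivative_iff_has_vector_derivative)
        qed
        show "norm (A t (Y n t)) \<le> N * (norm c * (N * \<bar>t - t0\<bar>) ^ n / fact n)"
          if "\<bar>t - t0\<bar> < R" for t
          using N[OF that, of "Y n t"] mult_left_mono[OF Suc.IH[OF that] N0] by linarith
      qed simp
    qed (simp add: Y0)
    moreover have "norm c * (N * \<bar>t - t0\<bar>) ^ n / fact n \<le> norm c * (N * R) ^ n / fact n"
      if "\<bar>t - t0\<bar> < R" for n t
      using that N0 by (intro divide_right_mono mult_left_mono power_mono) auto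
    ultimately have "norm (Y n t) \<le> norm c * (N * R) ^ n / fact n" if "\<bar>t - t0\<bar> < R" for n t
      using that order_trans by blast
    with N N0 show ?thesis by blast
  qed
  define y where "y t = (\<Sum>n. Y n t)" for t
  have main: "y t0 = c \<and> (y has_vector_derivative A t (y t)) (at t)" for t
  proof -
    define R where "R = \<bar>t - t0\<bar> + 1"
    obtain M where M: "0 \<le> M" "\<And>t y. \<bar>t - t0\<bar> < R \<Longrightarrow> norm (A t y) \<le> M * norm y"
      and Ybnd: "\<And>n t. \<bar>t - t0\<bar> < R \<Longrightarrow> norm (Y n t) \<le> norm c * (M * R) ^ n / fact n"
      using local_bound[of R] by blast
    define S where "S = ball t0 R"
    have S: "s \<in> S \<longleftrightarrow> \<bar>s - t0\<bar> < R" for s by (auto simp: S_def dist_real_def)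
    have summ: "summable (\<lambda>n. norm c * (M * R) ^ n / fact n)"
      using summable_mult[OF summable_exp[of "M * R"], of "norm c"] by (simp add: field_simps)
    have unif: "uniform_limit S (\<lambda>n x. \<Sum>i<n. Y i x) y sequentially"
      unfolding y_def
      by (rule Weierstrass_m_test[OF _ summ]) (simp add: Ybnd S)
    have sums: "(\<lambda>n. Y n s) sums y s" if "s \<in> S" for s
      using tendsto_uniform_limitI[OF unif that] by (simp add: sums_def)
    have openS: "open S" by (simp add: S_def)
    have t0: "t0 \<in> S" and t: "t \<in> S" by (auto simp: S R_def)
    have "Y n t0 = (if n = 0 then c else 0)" for n
      by (cases n) (simp_all add: Y0 Yt0)
    then have "(\<lambda>n. Y n t0) sums c"
      using sums_single[of 0 "\<lambda>_. c"] by simp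
    then have yt0: "y t0 = c" using sums_unique2[OF sums[OF t0]] by simp
    \<comment> \<open>Termwise differentiation of the series without its constant term
      \<open>Y 0\<close>: term \<open>Suc n\<close> has derivative \<open>A\<close> applied to term
      \<open>n\<close>, so the sum \<open>g\<close> has derivative \<open>A x (y x)\<close>, and
      \<open>y\<close> is \<open>g + c\<close>.\<close>
    have "\<exists>g. \<forall>x\<in>S. (\<lambda>n. Y (Suc n) x) sums g x \<and>
        (g has_derivative (\<lambda>h. h *\<^sub>R A x (y x))) (at x within S)"
    proof (rule has_derivative_series[where f' = "\<lambda>n x h. h *\<^sub>R A x (Y n x)"])
      show "convex S" by (simp add: S_def)
      show "(Y (Suc n) has_derivative (\<lambda>h. h *\<^sub>R A x (Y n x))) (at x within S)" for n x
        using Yder[of n x] has_derivative_at_withinI by (auto simp: has_vector_derivative_def)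
      show "(\<lambda>n. Y (Suc n) t0) sums 0" by (simp add: Yt0 sums_0)
      fix e :: real assume e: "0 < e"
      \<comment> \<open>The divisor is \<open>M + 1\<close> because \<open>M\<close> may be zero;
        the bound on \<open>A x\<close> turns this into an error of at most
        \<open>e\<close>.\<close>
      have "\<forall>\<^sub>F n in sequentially. \<forall>x\<in>S. dist (\<Sum>i<n. Y i x) (y x) < e / (M + 1)"
        using e M(1) by (intro uniform_limitD[OF unif]) auto
      then show "\<forall>\<^sub>F n in sequentially. \<forall>x\<in>S. \<forall>h.
          norm ((\<Sum>i<n. h *\<^sub>R A x (Y i x)) - h *\<^sub>R A x (y x)) \<le> e * norm h"
      proof eventually_elim
        case (elim n)
        show ?case
        proof (intro ballI allI)
          fix x h assume x: "x \<in> S"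
          interpret bounded_linear "A x" by (rule lin)
          have "(\<Sum>i<n. h *\<^sub>R A x (Y i x)) - h *\<^sub>R A x (y x) = h *\<^sub>R A x ((\<Sum>i<n. Y i x) - y x)"
            by (simp add: sum diff scaleR_sum_right scaleR_diff_right)
          moreover have "norm (A x ((\<Sum>i<n. Y i x) - y x)) \<le> M * (e / (M + 1))"
            using M x elim[rule_format, OF x]
            by (intro order_trans[OF M(2)] mult_left_mono) (auto simp: S dist_norm)
          moreover have "M * (e / (M + 1)) \<le> e" using M(1) e by (simp add: field_simps)
          ultimately have le: "norm (A x ((\<Sum>i<n. Y i x) - y x)) \<le> e"
            and "norm ((\<Sum>i<n. h *\<^sub>R A x (Y i x)) - h *\<^sub>R A x (y x)) =
              norm h * norm (A x ((\<Sum>i<n. Y i x) - y x))"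
            by simp_all
          then show "norm ((\<Sum>i<n. h *\<^sub>R A x (Y i x)) - h *\<^sub>R A x (y x)) \<le> e * norm h"
            using mult_left_mono[OF le, of "norm h"] by (simp add: mult.commute)
        qed
      qed
    qed (rule t0)
    then obtain g where "\<forall>x\<in>S. (\<lambda>n. Y (Suc n) x) sums g x \<and>
        (g has_derivative (\<lambda>h. h *\<^sub>R A x (y x))) (at x within S)" ..
    then have g: "(\<lambda>n. Y (Suc n) x) sums g x"
        "(g has_derivative (\<lambda>h. h *\<^sub>R A x (y x))) (at x within S)" if "x \<in> S" for x
      using that by simp_all
    have gy: "g x + c = y x" if "x \<in> S" for x
      using sums_unique2[OF sums[OF that]] g(1)[OF that] sums_Suc_iff[of "\<lambda>n. Y n x" "g x"]
      by (simp add: Y0)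
    have "(g has_vector_derivative A t (y t)) (at t)"
      using g(2)[OF t] unfolding has_vector_derivative_def at_within_open[OF t openS] .
    then have "((\<lambda>x. g x + c) has_vector_derivative A t (y t)) (at t)"
      by (auto intro!: derivative_eq_intros)
    then have "(y has_vector_derivative A t (y t)) (at t)"
      by (rule has_vector_derivative_transform_within_open[OF _ openS t]) (rule gy)
    with yt0 show ?thesis by blast
  qed
  show ?thesis using that[of y] main by blast
qed

subsection \<open>Unimodular matrices and decaying recurrences\<close>

text \<open>The characteristic roots are \<open>q\<close> and \<open>1 / q\<close>. The combination
  \<open>d\<close> cancels the \<open>q\<close> mode and is multiplied by \<open>1 / q\<close> at
  each step, so \<open>d (n + m) * q ^ m\<close> does not depend on \<open>m\<close>; as it tends to
  0, \<open>d\<close> vanishes and only the \<open>q\<close> mode remains.\<close>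

lemma decaying_solution_of_recurrence:
  fixes c :: "nat \<Rightarrow> 'a::real_normed_field"
  assumes rec: "\<And>n. c (Suc (Suc n)) = (q + 1 / q) * c (Suc n) - c n"
    and q: "q \<noteq> 0" "norm q < 1" and lim: "c \<longlonglongrightarrow> 0"
  shows "c n = q ^ n * c 0"
proof -
  define d where "d n = c (Suc n) - q * c n" for n
  have d_Suc: "d (Suc n) = d n / q" for n
    using q(1) by (simp add: d_def rec field_simps)
  have "c (Suc n) = q * c n" for n
  proof -
    have d: "d (n + m) * q ^ m = d n" for m
      using q(1) by (induction m) (simp_all add: d_Suc)
    have "d \<longlonglongrightarrow> 0 - q * 0"
      unfolding d_def by (intro tendsto_intros lim LIMSEQ_Suc)
    then have "(\<lambda>m. d (n + m)) \<longlonglongrightarrow> 0"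
      by (simp add: LIMSEQ_ignore_initial_segment add.commute)
    then have "(\<lambda>m. d (n + m) * q ^ m) \<longlonglongrightarrow> 0 * 0"
      using LIMSEQ_power_zero[OF q(2)] by (rule tendsto_mult)
    then have "d n = 0" by (simp add: d LIMSEQ_const_iff)
    then show ?thesis by (simp add: d_def)
  qed
  then show ?thesis by (induction n) simp_all
qed

lemma matrix_vector_mult_2:
  fixes T :: "'a::semiring_1^2^2"
  shows "T *v v = vector [T$1$1 * v$1 + T$1$2 * v$2, T$2$1 * v$1 + T$2$2 * v$2]"
  by (simp add: vec_eq_iff forall_2 matrix_vector_mult_def sum_2)

lemma eigenvalue_iff_characteristic_root:
  "eigenvalue T t \<longleftrightarrow> t\<^sup>2 - (T$1$1 + T$2$2) * t + det T = 0"
proof -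
  have "eigenvalue T t \<longleftrightarrow> (\<exists>v. v \<noteq> 0 \<and> (T - mat t) *v v = 0)"
    unfolding eigenvalue_def
    by (simp add: vec_eq_iff forall_2 matrix_vector_mult_2 mat_def algebra_simps)
  also have "\<dots> \<longleftrightarrow> det (T - mat t) = 0"
    using matrix_left_invertible_ker[of "T - mat t"] invertible_left_inverse[of "T - mat t"]
      invertible_det_nz[of "T - mat t"] by blast
  also have "det (T - mat t) = t\<^sup>2 - (T$1$1 + T$2$2) * t + det T"
    by (simp add: det_2 mat_def power2_eq_square algebra_simps)
  finally show ?thesis .
qed

text \<open>The roots of the characteristic polynomial have product \<open>det T = 1\<close>. With
  modulus one excluded, exactly one of \<open>r\<close> and \<open>1 / r\<close> lies in the open
  unit disc, and that one is \<open>q\<close>.\<close>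

lemma unimodular_contracting_eigenvalue:
  assumes det: "det T = 1" and no: "\<And>t. eigenvalue T t \<Longrightarrow> norm t \<noteq> 1"
  obtains q where "q \<noteq> 0" "norm q < 1" "T$1$1 + T$2$2 = q + 1 / q"
    "\<And>t. eigenvalue T t \<and> norm t < 1 \<longleftrightarrow> t = q"
proof -
  define \<tau> where "\<tau> = T$1$1 + T$2$2"
  have ev: "eigenvalue T t \<longleftrightarrow> t\<^sup>2 - \<tau> * t + 1 = 0" for t
    by (simp add: eigenvalue_iff_characteristic_root det \<tau>_def)
  define r where "r = (\<tau> + csqrt (\<tau>\<^sup>2 - 4)) / 2"
  have "2 * r - \<tau> = csqrt (\<tau>\<^sup>2 - 4)" by (simp add: r_def field_simps)
  then have "(2 * r - \<tau>)\<^sup>2 = \<tau>\<^sup>2 - 4" by simp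
  moreover have "(2 * r - \<tau>)\<^sup>2 = \<tau>\<^sup>2 - 4 + 4 * (r\<^sup>2 - \<tau> * r + 1)"
    by (simp add: power2_eq_square algebra_simps)
  ultimately have "4 * (r\<^sup>2 - \<tau> * r + 1) = 0" by (metis add_cancel_right_right)
  then have r: "r\<^sup>2 - \<tau> * r + 1 = 0" by (metis mult_eq_0_iff zero_neq_numeral)
  then have r0: "r \<noteq> 0" by auto
  define q where "q = (if norm r < 1 then r else 1 / r)"
  have \<tau>: "\<tau> = r + 1 / r" using r r0 by (simp add: field_simps power2_eq_square)
  have q: "q \<noteq> 0" "\<tau> = q + 1 / q" using r0 \<tau> by (auto simp: q_def)
  have "norm r \<noteq> 1" using no ev r by blast
  then have q1: "norm q < 1" using r0 by (auto simp: q_def norm_divide divide_simps)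
  have ev_q: "eigenvalue T t \<longleftrightarrow> t = q \<or> t = 1 / q" for t
  proof -
    have "t\<^sup>2 - \<tau> * t + 1 = (t - q) * (t - 1 / q)"
      unfolding q(2) using q(1) by (simp add: field_simps power2_eq_square)
    then show ?thesis by (simp add: ev)
  qed
  have "norm (1 / q) > 1" using q q1 by (simp add: norm_divide)
  then have "eigenvalue T t \<and> norm t < 1 \<longleftrightarrow> t = q" for t
    using q1 by (auto simp: ev_q)
  with q q1 show ?thesis using that[of q] by (simp add: \<tau>_def)
qed

subsection \<open>The first-order system for the field and its flux\<close>

text \<open>Here \<open>w\<close> is the flux and \<open>k\<close> will be
  \<open>\<mu> * \<omega>\<^sup>2\<close>. Written this way nothing is divided by \<open>e\<close>,
  and \<open>w\<close> has a continuous derivative even where \<open>u'\<close> would jump.\<close>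

definition system_solution ::
    "complex \<Rightarrow> (real \<Rightarrow> complex) \<Rightarrow> (real \<Rightarrow> complex) \<Rightarrow> (real \<Rightarrow> complex) \<Rightarrow> bool" where
  "system_solution k e u w \<longleftrightarrow> continuous_on UNIV u \<and> continuous_on UNIV w \<and>
     (\<forall>x. isCont e x \<longrightarrow>
        (u has_vector_derivative e x * w x) (at x) \<and> (w has_vector_derivative - k * u x) (at x))"

text \<open>If \<open>E\<close> is an antiderivative of \<open>e\<close>, then \<open>p = u - E w\<close> satisfies \<open>p' = k E u\<close>, so that
  \<open>(p, w)\<close> solves a linear system whose coefficients are continuous although \<open>e\<close> is not.\<close>

lemma system_solution_exists:
  assumes e: "\<And>a b. e integrable_on {a..b}"
  obtains u w where "system_solution k e u w" "u t0 = a" "w t0 = b"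
proof -
  obtain E where E0: "E t0 = 0" and Econt: "continuous_on UNIV E"
    and E: "\<And>t. isCont e t \<Longrightarrow> (E has_vector_derivative e t) (at t)"
    using antiderivative_exists[OF e] by metis
  define A where "A t y = (k * E t * (fst y + E t * snd y), - k * (fst y + E t * snd y))" for t y
  have "\<exists>y. y t0 = (a, b) \<and> (\<forall>t. (y has_vector_derivative A t (y t)) (at t))"
  proof (rule linear_ode_solution_exists)
    show "bounded_linear (A t)" for t
      unfolding A_def
      by (intro bounded_linear_Pair bounded_linear_const_mult bounded_linear_add bounded_linear_fst
          bounded_linear_snd bounded_linear_compose[OF bounded_linear_const_mult] )
    show "continuous_on UNIV (\<lambda>t. A t (y t))" if "continuous_on UNIV y" for y
      unfolding A_def using that by (intro continuous_intros Econt)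
    show "\<exists>M. \<forall>t y. \<bar>t - t0\<bar> < R \<longrightarrow> norm (A t y) \<le> M * norm y" for R
    proof -
      have "compact (E ` {t0 - R..t0 + R})"
        by (intro compact_continuous_image continuous_on_subset[OF Econt]) auto
      then obtain B where B: "\<forall>z\<in>E ` {t0 - R..t0 + R}. norm z \<le> B"
        using compact_imp_bounded bounded_iff by metis
      \<comment> \<open>As \<open>B\<close> bounds \<open>E\<close>, the recovered field
        \<open>fst y + E t * snd y\<close> is at most \<open>(1 + B) * norm y\<close>; the two
        components of \<open>A t y\<close> multiply it by \<open>k * E t\<close> and
        \<open>- k\<close>.\<close>
      have "norm (A t y) \<le> (norm k * B + norm k) * (1 + B) * norm y" if "\<bar>t - t0\<bar> < R" for t y
      proof -
        have Et: "norm (E t) \<le> B" using B that by (auto simp: abs_less_iff)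
        then have B0: "0 \<le> B" using norm_ge_zero order_trans by blast
        have "norm (fst y + E t * snd y) \<le> norm y + B * norm y"
          using norm_triangle_ineq[of "fst y" "E t * snd y"] norm_fst_le[of "fst y" "snd y"]
            mult_mono[OF Et norm_snd_le[of "snd y" "fst y"] B0] by (simp add: norm_mult)
        moreover have "norm (A t y) \<le> norm (k * E t * (fst y + E t * snd y)) + norm (- k * (fst y + E t * snd y))"
          unfolding A_def by (rule norm_Pair_le)
        moreover have "\<dots> = (norm k * norm (E t) + norm k) * norm (fst y + E t * snd y)"
          by (simp only: norm_mult norm_minus_cancel distrib_right)
        moreover have "\<dots> \<le> (norm k * B + norm k) * (norm y + B * norm y)"
          using calculation(1) Et B0 by (intro mult_mono add_mono order_refl) auto
        ultimately show ?thesis by (simp add: algebra_simps)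
      qed
      then show ?thesis by blast
    qed
  qed blast
  then obtain y where y0: "y t0 = (a, b)" and y: "\<And>t. (y has_vector_derivative A t (y t)) (at t)"
    by blast
  define p where "p t = fst (y t)" for t
  define w where "w t = snd (y t)" for t
  define u where "u t = p t + E t * w t" for t
  have p: "(p has_vector_derivative k * E t * u t) (at t)" for t
    using bounded_linear.has_vector_derivative[OF bounded_linear_fst y]
    by (simp add: A_def u_def p_def w_def[abs_def] p_def[abs_def])
  have w: "(w has_vector_derivative - k * u t) (at t)" for t
    using bounded_linear.has_vector_derivative[OF bounded_linear_snd y]
    by (simp add: A_def u_def p_def w_def[abs_def] p_def[abs_def])
  have contp: "continuous_on UNIV p" and contw: "continuous_on UNIV w"
    using has_vector_derivative_continuous[OF p] has_vector_derivative_continuous[OF w]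
    by (auto simp: continuous_on_eq_continuous_at)
  have contu: "continuous_on UNIV u"
    unfolding u_def by (intro continuous_intros contp contw Econt)
  have u: "(u has_vector_derivative e t * w t) (at t)" if "isCont e t" for t
  proof -
    have "((\<lambda>t. p t + E t * w t) has_vector_derivative
        k * E t * u t + (E t * (- k * u t) + e t * w t)) (at t)"
      by (intro has_vector_derivative_add has_vector_derivative_mult p w E that)
    then show ?thesis by (simp add: u_def[abs_def])
  qed
  \<comment> \<open>Since \<open>E t0 = 0\<close>, the initial value of \<open>p\<close> is also
    that of \<open>u\<close>.\<close>
  show ?thesis
    using that[of u w] u w contu contw y0 by (simp add: system_solution_def E0 u_def p_def w_def)
qed

text \<open>In the derivative of the Wronskian the terms with \<open>e\<close> and those with
  \<open>k\<close> cancel separately, and continuity carries the constancy across the finite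
  exceptional set. The equations are required only inside the interval, so that a solution known on
  a half-line can be paired with a global one.\<close>

lemma wronskian_eq:
  fixes u v w z :: "real \<Rightarrow> complex"
  assumes ab: "a \<le> b" and K: "finite (K \<inter> {a..b})"
    and cont: "continuous_on {a..b} u" "continuous_on {a..b} w"
      "continuous_on {a..b} v" "continuous_on {a..b} z"
    and u: "\<And>x. x \<in> {a<..<b} - K \<Longrightarrow>
      (u has_vector_derivative e x * w x) (at x) \<and> (w has_vector_derivative - k * u x) (at x)"
    and v: "\<And>x. x \<in> {a<..<b} - K \<Longrightarrow>
      (v has_vector_derivative e x * z x) (at x) \<and> (z has_vector_derivative - k * v x) (at x)"
  shows "u b * z b - w b * v b = u a * z a - w a * v a"
proof -
  let ?W = "\<lambda>x. u x * z x - w x * v x"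
  have "?W b = ?W a"
  proof (rule has_derivative_zero_unique_strong_interval)
    show "finite (K \<inter> {a..b} \<union> {a, b})" using K by simp
    show "continuous_on {a..b} ?W" by (intro continuous_intros cont)
    show "?W a = ?W a" ..
    show "b \<in> {a..b}" using ab by simp
    fix x assume x: "x \<in> {a..b} - (K \<inter> {a..b} \<union> {a, b})"
    then have x': "x \<in> {a<..<b} - K" by auto
    have "(?W has_vector_derivative u x * (- k * v x) + e x * w x * z x -
        (w x * (e x * z x) + - k * u x * v x)) (at x)"
      using u[OF x'] v[OF x'] by (intro has_vector_derivative_diff has_vector_derivative_mult) auto
    then have "(?W has_vector_derivative 0) (at x)" by (simp add: algebra_simps)
    then show "(?W has_derivative (\<lambda>h. 0)) (at x within {a..b})"
      by (simp add: has_vector_derivative_def has_derivative_at_withinI)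
  qed
  then show ?thesis .
qed

lemma finite_Int_Icc:
  fixes S :: "real set"
  assumes "\<And>a. finite (S \<inter> {a..a + 1})"
  shows "finite (S \<inter> {a..b})"
proof -
  have "finite (S \<inter> {a..a + real n})" for n
  proof (induction n)
    case 0
    then show ?case by (rule finite_subset[OF _ assms[of a]]) auto
  next
    case (Suc n)
    have "S \<inter> {a..a + real (Suc n)} \<subseteq> (S \<inter> {a..a + real n}) \<union> (S \<inter> {a + real n..a + real n + 1})"
      by auto
    then show ?case using Suc assms finite_subset by (meson finite_UnI)
  qed
  from this[of "nat \<lceil>b - a\<rceil>"] show ?thesis
    by (rule finite_subset[rotated]) (auto, linarith)
qed

lemma piecewise_smooth_discontinuities:
  assumes "piecewise_smooth f"
  shows "finite ({x. \<not> isCont f x} \<inter> {a..b})"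
proof -
  obtain S where S: "\<And>a. finite (S \<inter> {a..a + 1})" and "smooth_on (- S) f"
    using assms by (auto simp: piecewise_smooth_def)
  then have "isCont f x" if "x \<notin> S" for x
    using that by (auto simp: smooth_on_def intro: has_vector_derivative_continuous)
  then have "{x. \<not> isCont f x} \<inter> {a..b} \<subseteq> S \<inter> {a..b}" by auto
  then show ?thesis using finite_Int_Icc[OF S] finite_subset by blast
qed

lemma system_solution_combination:
  assumes "system_solution k e u w" "system_solution k e v z"
  shows "system_solution k e (\<lambda>x. a * u x + b * v x) (\<lambda>x. a * w x + b * z x)"
proof -
  have "((\<lambda>x. a * u x + b * v x) has_vector_derivative e x * (a * w x + b * z x)) (at x)"
    "((\<lambda>x. a * w x + b * z x) has_vector_derivative - k * (a * u x + b * v x)) (at x)"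
    if "isCont e x" for x
  proof -
    have "((\<lambda>x. a * u x + b * v x) has_vector_derivative a * (e x * w x) + b * (e x * z x)) (at x)"
      "((\<lambda>x. a * w x + b * z x) has_vector_derivative a * (- k * u x) + b * (- k * v x)) (at x)"
      by (intro has_vector_derivative_add has_vector_derivative_mult_right;
        use assms that in \<open>simp add: system_solution_def\<close>)+
    then show
      "((\<lambda>x. a * u x + b * v x) has_vector_derivative e x * (a * w x + b * z x)) (at x)"
      "((\<lambda>x. a * w x + b * z x) has_vector_derivative - k * (a * u x + b * v x)) (at x)"
      by (simp_all add: algebra_simps)
  qed
  then show ?thesis
    using assms by (auto simp: system_solution_def intro!: continuous_intros)
qed

text \<open>Cramer's rule for the Wronskians of \<open>u\<close> with the two fundamental solutions.\<close>

lemma system_solution_representation: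
  fixes u w \<theta> \<eta> \<phi> \<psi> :: "real \<Rightarrow> complex"
  assumes K: "\<And>a b. finite (K \<inter> {a..b})" and eK: "\<And>x. x \<notin> K \<Longrightarrow> isCont e x"
    and S: "is_interval S" "t0 \<in> S" "t \<in> S"
    and cont: "continuous_on S u" "continuous_on S w"
    and u: "\<And>x. x \<in> interior S - K \<Longrightarrow>
      (u has_vector_derivative e x * w x) (at x) \<and> (w has_vector_derivative - k * u x) (at x)"
    and \<theta>: "system_solution k e \<theta> \<eta>" "\<theta> t0 = 1" "\<eta> t0 = 0"
    and \<phi>: "system_solution k e \<phi> \<psi>" "\<phi> t0 = 0" "\<psi> t0 = 1"
  shows "u t = u t0 * \<theta> t + w t0 * \<phi> t" and "w t = u t0 * \<eta> t + w t0 * \<psi> t"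
proof -
  \<comment> \<open>The point \<open>t\<close> may lie on either side of \<open>t0\<close>;
    \<open>flip\<close> transfers equality at the ordered end points back to \<open>t\<close> and
    \<open>t0\<close>.\<close>
  define a b where "a = min t t0" and "b = max t t0"
  have "a \<in> S" "b \<in> S" using S by (auto simp: a_def b_def min_def max_def)
  then have ab_S: "{a..b} \<subseteq> S"
    using S(1) unfolding is_interval_1 by fastforce
  then have ab_int: "{a<..<b} \<subseteq> interior S"
    by (intro interior_maximal) auto
  have ab: "a \<le> b" by (simp add: a_def b_def)
  have flip: "f t = f t0" if "f b = f a" for f :: "real \<Rightarrow> complex"
    using that by (auto simp: a_def b_def min_def max_def split: if_splits)
  have sys: "continuous_on A p" "continuous_on A q"
    "x \<notin> K \<Longrightarrow> (p has_vector_derivative e x * q x) (at x) \<and> (q has_vector_derivative - k * p x) (at x)"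
    if "system_solution k e p q" for A p q x
    using that eK unfolding system_solution_def by (blast intro: continuous_on_subset)+
  have u_ab: "(u has_vector_derivative e x * w x) (at x) \<and> (w has_vector_derivative - k * u x) (at x)"
    if "x \<in> {a<..<b} - K" for x
    using that ab_int by (intro u) auto
  have W: "u t * z t - w t * v t = u t0 * z t0 - w t0 * v t0" if "system_solution k e v z" for v z
    by (rule flip[where f = "\<lambda>t. u t * z t - w t * v t"], rule wronskian_eq[OF ab K])
      (use cont ab_S u_ab sys[OF that] in \<open>auto intro: continuous_on_subset\<close>)
  have "\<theta> t * \<psi> t - \<eta> t * \<phi> t = \<theta> t0 * \<psi> t0 - \<eta> t0 * \<phi> t0"
    by (rule flip[where f = "\<lambda>t. \<theta> t * \<psi> t - \<eta> t * \<phi> t"], rule wronskian_eq[OF ab K])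
      (use sys[OF \<theta>(1)] sys[OF \<phi>(1)] in auto)
  then have 1: "\<theta> t * \<psi> t - \<eta> t * \<phi> t = 1" using \<theta> \<phi> by simp
  have 2: "u t * \<eta> t - w t * \<theta> t = - w t0" using W[OF \<theta>(1)] \<theta> by simp
  have 3: "u t * \<psi> t - w t * \<phi> t = u t0" using W[OF \<phi>(1)] \<phi> by simp
  have "u t = u t * (\<theta> t * \<psi> t - \<eta> t * \<phi> t)" by (simp add: 1)
  also have "\<dots> = (u t * \<psi> t - w t * \<phi> t) * \<theta> t - (u t * \<eta> t - w t * \<theta> t) * \<phi> t"
    by (simp add: algebra_simps)
  finally show "u t = u t0 * \<theta> t + w t0 * \<phi> t" by (simp only: 2 3) simp
  have "w t = w t * (\<theta> t * \<psi> t - \<eta> t * \<phi> t)" by (simp add: 1)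
  also have "\<dots> = (u t * \<psi> t - w t * \<phi> t) * \<eta> t - (u t * \<eta> t - w t * \<theta> t) * \<psi> t"
    by (simp add: algebra_simps)
  finally show "w t = u t0 * \<eta> t + w t0 * \<psi> t" by (simp only: 2 3) simp
qed

lemma has_vector_derivative_translate_iff:
  fixes f :: "real \<Rightarrow> 'a::real_normed_vector"
  shows "((\<lambda>x. f (x + c)) has_vector_derivative d) (at x) \<longleftrightarrow>
    (f has_vector_derivative d) (at (x + c))"
proof -
  have *: "((\<lambda>x. g (x + a)) has_vector_derivative d) (at y)"
    if "(g has_vector_derivative d) (at (y + a))" for g :: "real \<Rightarrow> 'a" and a y
  proof -
    have "((\<lambda>x. x + a) has_vector_derivative 1) (at y)"
      by (auto intro!: derivative_eq_intros)
    from vector_diff_chain_at[OF this that] show ?thesis by (simp add: o_def)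
  qed
  show ?thesis using *[of f x c] *[of "\<lambda>x. f (x + c)" "x + c" "- c"] by auto
qed

lemma cauchy_data_shift: "cauchy_data x0 (\<lambda>x. u (x + of_int m)) n = cauchy_data x0 u (n + m)"
  by (simp add: cauchy_data_def vector_derivative_def has_vector_derivative_translate_iff add.assoc)

subsection \<open>Periodic symmetric media\<close>

locale symmetric_medium =
  fixes \<mu> x0 :: real and \<epsilon> :: "real \<Rightarrow> complex" and \<omega> :: complex
  assumes \<mu>_pos: "\<mu> > 0" and permittivity: "permittivity x0 \<epsilon>"
begin

definition nodes :: "real set" where
  "nodes = range (\<lambda>n::int. x0 + of_int n)"

definition \<epsilon>_node :: complex where
  "\<epsilon>_node = Lim (at x0) \<epsilon>"

text \<open>The value of \<open>\<epsilon>\<close> at a node is unconstrained; replacing it by the two-sided limit makes the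
  coefficient continuous there, so that all solutions are differentiable at the nodes.\<close>

definition e :: "real \<Rightarrow> complex" where
  "e x = (if x \<in> nodes then \<epsilon>_node else \<epsilon> x)"

definition k :: complex where
  "k = of_real \<mu> * \<omega>\<^sup>2"

section \<open>The coefficient near the nodes\<close>

lemma \<epsilon>_nz: "\<epsilon> x \<noteq> 0"
proof -
  have "Re (\<epsilon> x) > 0" using permittivity by (auto simp: permittivity_def)
  then show ?thesis by auto
qed

lemma \<epsilon>_periodic: "\<epsilon> (x + of_int n) = \<epsilon> x"
proof -
  have 1: "\<epsilon> (y + 1) = \<epsilon> y" for y using permittivity by (auto simp: permittivity_def)
  have 2: "\<epsilon> (y + real m) = \<epsilon> y" for y m
  proof (induction m)
    case (Suc m)
    then show ?case using 1[of "y + real m"] by (simp add: add_ac)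
  qed simp
  show ?thesis
  proof (cases n rule: int_cases2)
    case (nonneg m)
    then show ?thesis using 2 by simp
  next
    case (nonpos m)
    then show ?thesis using 2[of "x - real m" m] by simp
  qed
qed

lemma nodes_shift: "x + of_int n \<in> nodes \<longleftrightarrow> x \<in> nodes"
proof -
  have "y + of_int m \<in> nodes" if "y \<in> nodes" for y m
    using that by (auto simp: nodes_def add.assoc simp flip: of_int_add)
  from this[of x n] this[of "x + of_int n" "- n"] show ?thesis by auto
qed

lemma e_periodic: "e (x + of_int n) = e x"
  by (simp add: e_def nodes_shift \<epsilon>_periodic)

lemma finite_nodes: "finite (nodes \<inter> {a..b})"
proof -
  have "nodes \<inter> {a..b} \<subseteq> (\<lambda>n::int. x0 + of_int n) ` {\<lfloor>a - x0\<rfloor>..\<lceil>b - x0\<rceil>}"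
    by (auto simp: nodes_def intro!: imageI) linarith+
  then show ?thesis by (rule finite_subset) simp
qed

text \<open>The nodes are locally finite, so altering \<open>\<epsilon>\<close> at them is invisible
  in small punctured neighbourhoods; limits and one-sided limits are therefore unchanged.\<close>

lemma e_eq_near: "eventually (\<lambda>y. e y = \<epsilon> y) (at x)"
proof -
  define U where "U = {x - 1<..<x + 1} - (nodes \<inter> {x - 1..x + 1} - {x})"
  have "open U" "x \<in> U"
    unfolding U_def by (auto intro!: open_Diff finite_imp_closed finite_nodes)
  moreover have "e y = \<epsilon> y" if "y \<in> U" "y \<noteq> x" for y
    using that by (auto simp: U_def e_def)
  ultimately show ?thesis by (auto simp: eventually_at_topological)
qed

lemma e_tendsto_iff:
  "(e \<longlongrightarrow> l) (at x within S) \<longleftrightarrow> (\<epsilon> \<longlongrightarrow> l) (at x within S)"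
  by (intro tendsto_cong filter_leD[OF at_le[OF subset_UNIV] e_eq_near])

text \<open>Periodicity and inversion symmetry combine to a reflection about \<open>x0\<close>
  itself, so the left limit equals the right one. It is nonzero because one-sided limits have
  positive real part.\<close>

lemma \<epsilon>_tendsto_x0: obtains l where "(\<epsilon> \<longlongrightarrow> l) (at x0)" "l \<noteq> 0"
proof -
  obtain l where l: "(\<epsilon> \<longlongrightarrow> l) (at_right x0)"
    using permittivity unfolding permittivity_def piecewise_smooth_def by blast
  have "(\<epsilon> \<longlongrightarrow> l) (at_left x0)"
  proof -
    have refl: "\<epsilon> (x0 - h) = \<epsilon> (x0 + h)" if "0 < h" "h < 1" for h
      using that permittivity \<epsilon>_periodic[of "x0 - h" 1] by (auto simp: permittivity_def algebra_simps)
    have "((\<lambda>h. \<epsilon> (x0 + h)) \<longlongrightarrow> l) (at_right 0)"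
      using l by (simp add: filterlim_at_right_to_0[of \<epsilon> _ x0] add.commute)
    then have "((\<lambda>h. \<epsilon> (x0 - h)) \<longlongrightarrow> l) (at_right 0)"
      by (rule tendsto_cong[THEN iffD1, rotated])
        (auto simp: eventually_at_right_field refl intro!: exI[of _ 1])
    then show ?thesis
      by (simp add: filterlim_at_left_to_right filterlim_at_right_to_0[of _ _ "- x0"])
  qed
  with l have "(\<epsilon> \<longlongrightarrow> l) (at x0)" by (simp add: filterlim_at_split)
  moreover have "Re l > 0" using l permittivity by (auto simp: permittivity_def)
  then have "l \<noteq> 0" by auto
  ultimately show ?thesis by (rule that)
qed

lemma \<epsilon>_node: "(\<epsilon> \<longlongrightarrow> \<epsilon>_node) (at x0)" "\<epsilon>_node \<noteq> 0"
proof -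
  obtain l where l: "(\<epsilon> \<longlongrightarrow> l) (at x0)" "l \<noteq> 0" by (rule \<epsilon>_tendsto_x0)
  then have "\<epsilon>_node = l" unfolding \<epsilon>_node_def by (intro tendsto_Lim) auto
  with l show "(\<epsilon> \<longlongrightarrow> \<epsilon>_node) (at x0)" "\<epsilon>_node \<noteq> 0" by auto
qed

lemma isCont_e_shift:
  assumes "isCont e x"
  shows "isCont e (x + of_int n)"
proof -
  have "isCont (\<lambda>y. e (y - of_int n)) (x + of_int n)"
    by (rule isCont_o2[where f = "\<lambda>y. y - of_int n" and g = e and a = "x + of_int n"])
      (use assms in \<open>auto intro!: continuous_intros\<close>)
  moreover have "e (y - of_int n) = e y" for y using e_periodic[of y "- n"] by simp
  ultimately show ?thesis by simp
qed

lemma isCont_e_node: "isCont e (x0 + of_int n)" and e_node: "e (x0 + of_int n) = \<epsilon>_node"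
proof -
  have "x0 + of_int m \<in> nodes" for m by (auto simp: nodes_def)
  then have e: "e (x0 + of_int m) = \<epsilon>_node" for m by (simp add: e_def)
  then show "e (x0 + of_int n) = \<epsilon>_node" .
  have "isCont e x0"
    using \<epsilon>_node(1) e[of 0] by (simp add: isCont_def e_tendsto_iff)
  then show "isCont e (x0 + of_int n)" by (rule isCont_e_shift)
qed

text \<open>At a node, continuity of \<open>\<epsilon>\<close> forces its value to be the limit
  \<open>\<epsilon>_node\<close>, which is the value of \<open>e\<close>.\<close>

lemma isCont_\<epsilon>D: assumes "isCont \<epsilon> x" shows "isCont e x" and "e x = \<epsilon> x"
proof -
  show *: "e x = \<epsilon> x"
  proof (cases "x \<in> nodes")
    case True
    then obtain n where "x = x0 + of_int n" by (auto simp: nodes_def)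
    then have "(e \<longlongrightarrow> e x) (at x)" using isCont_e_node[of n] by (simp add: isCont_def)
    moreover have "(e \<longlongrightarrow> \<epsilon> x) (at x)" using assms by (simp add: isCont_def e_tendsto_iff)
    ultimately show ?thesis by (rule tendsto_unique[rotated]) simp
  qed (simp add: e_def)
  show "isCont e x" using assms by (simp add: isCont_def * e_tendsto_iff)
qed

text \<open>Defined through \<open>\<epsilon>\<close> rather than \<open>e\<close>, because
  \<open>solution\<close> imposes the equation where \<open>\<epsilon>\<close> is continuous; all
  discontinuities of \<open>e\<close> lie in this set.\<close>

definition K :: "real set" where
  "K = {x. \<not> isCont \<epsilon> x}"

lemma finite_K: "finite (K \<inter> {a..b})"
  unfolding K_def using permittivity
  by (intro piecewise_smooth_discontinuities) (simp add: permittivity_def)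

lemma integrable_e: "e integrable_on {a..b}"
proof (rule integrable_bounded_finite_discontinuities[OF _ finite_K])
  show "bounded (e ` {a..b})"
    using permittivity unfolding permittivity_def piecewise_smooth_def
    by (intro bounded_image_if_one_sided_limits) (simp_all add: e_tendsto_iff)
qed (simp add: K_def isCont_\<epsilon>D)

lemma system_solution_shift:
  assumes "system_solution k e u w"
  shows "system_solution k e (\<lambda>x. u (x + of_int n)) (\<lambda>x. w (x + of_int n))"
  unfolding system_solution_def
proof (intro conjI allI impI)
  have cont: "continuous_on UNIV (\<lambda>x. f (x + of_int n))" if "continuous_on UNIV f"
    for f :: "real \<Rightarrow> complex"
    by (rule continuous_on_compose2[OF that]) (auto intro!: continuous_intros)
  show "continuous_on UNIV (\<lambda>x. u (x + of_int n))" "continuous_on UNIV (\<lambda>x. w (x + of_int n))"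
    using assms by (auto simp: system_solution_def intro: cont)
  fix x assume "isCont e x"
  then have "isCont e (x + of_int n)" by (rule isCont_e_shift)
  then have "(u has_vector_derivative e (x + of_int n) * w (x + of_int n)) (at (x + of_int n))"
    "(w has_vector_derivative - k * u (x + of_int n)) (at (x + of_int n))"
    using assms by (auto simp: system_solution_def)
  then show "((\<lambda>x. u (x + of_int n)) has_vector_derivative e x * w (x + of_int n)) (at x)"
    "((\<lambda>x. w (x + of_int n)) has_vector_derivative - k * u (x + of_int n)) (at x)"
    by (simp_all add: has_vector_derivative_translate_iff e_periodic)
qed

section \<open>Fundamental solutions and continuation from an interval\<close>

definition fundamental ::
    "(real \<Rightarrow> complex) \<Rightarrow> (real \<Rightarrow> complex) \<Rightarrow> (real \<Rightarrow> complex) \<Rightarrow> (real \<Rightarrow> complex) \<Rightarrow> bool" where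
  "fundamental \<theta> \<eta> \<phi> \<psi> \<longleftrightarrow>
     system_solution k e \<theta> \<eta> \<and> \<theta> x0 = 1 \<and> \<eta> x0 = 0 \<and>
     system_solution k e \<phi> \<psi> \<and> \<phi> x0 = 0 \<and> \<psi> x0 = 1"

lemma fundamental_exists: obtains \<theta> \<eta> \<phi> \<psi> where "fundamental \<theta> \<eta> \<phi> \<psi>"
proof -
  obtain \<theta> \<eta> where 1: "system_solution k e \<theta> \<eta>" "\<theta> x0 = 1" "\<eta> x0 = 0"
    by (rule system_solution_exists[OF integrable_e])
  obtain \<phi> \<psi> where 2: "system_solution k e \<phi> \<psi>" "\<phi> x0 = 0" "\<psi> x0 = 1"
    by (rule system_solution_exists[OF integrable_e])
  show ?thesis using that 1 2 unfolding fundamental_def by blast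
qed

lemma fundamental_representation:
  assumes F: "fundamental \<theta> \<eta> \<phi> \<psi>" and S: "is_interval S" "x0 \<in> S" "t \<in> S"
    and cont: "continuous_on S u" "continuous_on S w"
    and der: "\<And>x. x \<in> interior S \<Longrightarrow> isCont \<epsilon> x \<Longrightarrow>
      (u has_vector_derivative \<epsilon> x * w x) (at x) \<and> (w has_vector_derivative - k * u x) (at x)"
  shows "u t = u x0 * \<theta> t + w x0 * \<phi> t" and "w t = u x0 * \<eta> t + w x0 * \<psi> t"
proof -
  have eK: "isCont e x" if "x \<notin> K" for x
    using that by (simp add: K_def isCont_\<epsilon>D)
  have der': "(u has_vector_derivative e x * w x) (at x) \<and> (w has_vector_derivative - k * u x) (at x)"
    if "x \<in> interior S - K" for x
    using der[of x] that by (simp add: K_def isCont_\<epsilon>D)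
  have F1: "system_solution k e \<theta> \<eta>" "\<theta> x0 = 1" "\<eta> x0 = 0"
    and F2: "system_solution k e \<phi> \<psi>" "\<phi> x0 = 0" "\<psi> x0 = 1"
    using F by (simp_all add: fundamental_def)
  note rep = system_solution_representation[OF finite_K eK S cont der' F1 F2]
  show "u t = u x0 * \<theta> t + w x0 * \<phi> t" by (rule rep(1))
  show "w t = u x0 * \<eta> t + w x0 * \<psi> t" by (rule rep(2))
qed

lemma system_solution_derivatives:
  assumes "system_solution k e u w" and "isCont \<epsilon> x"
  shows "(u has_vector_derivative \<epsilon> x * w x) (at x) \<and> (w has_vector_derivative - k * u x) (at x)"
proof -
  have "isCont e x" and "e x = \<epsilon> x" using isCont_\<epsilon>D[OF assms(2)] .
  then show ?thesis using assms(1) unfolding system_solution_def by metis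
qed

text \<open>The representation by fundamental solutions makes sense on the whole line and solves the
  system there. With \<open>S\<close> a half-line it continues the mode into the periodic medium;
  with \<open>S\<close> the whole line it adds the equation at nodes where only \<open>e\<close> is
  continuous.\<close>

lemma system_solution_extension:
  assumes S: "is_interval S" "x0 \<in> S"
    and cont: "continuous_on S u" "continuous_on S w"
    and der: "\<And>x. x \<in> interior S \<Longrightarrow> isCont \<epsilon> x \<Longrightarrow>
      (u has_vector_derivative \<epsilon> x * w x) (at x) \<and> (w has_vector_derivative - k * u x) (at x)"
  obtains v z where "system_solution k e v z" and "\<forall>x\<in>S. v x = u x \<and> z x = w x"
proof -
  obtain \<theta> \<eta> \<phi> \<psi> where F: "fundamental \<theta> \<eta> \<phi> \<psi>" by (rule fundamental_exists)
  have "system_solution k e (\<lambda>x. u x0 * \<theta> x + w x0 * \<phi> x) (\<lambda>x. u x0 * \<eta> x + w x0 * \<psi> x)"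
    using F by (intro system_solution_combination) (auto simp: fundamental_def)
  then show ?thesis
    by (rule that) (use fundamental_representation[OF F S _ cont der] in auto)
qed

text \<open>The coefficient is arbitrary because the lemma serves both a periodic medium and the
  interface.\<close>

lemma solution_fluxE:
  assumes "solution \<mu> \<epsilon>' \<omega> u"
  obtains w where "continuous_on UNIV u" "continuous_on UNIV w"
    "\<forall>x. isCont \<epsilon>' x \<longrightarrow> \<epsilon>' x \<noteq> 0 \<longrightarrow>
      (u has_vector_derivative \<epsilon>' x * w x) (at x) \<and> (w has_vector_derivative - k * u x) (at x)"
proof -
  obtain w where u: "continuous_on UNIV u" and w: "continuous_on UNIV w"
    and der: "\<forall>x. isCont \<epsilon>' x \<longrightarrow>
           (\<exists>u' w'. (u has_vector_derivative u') (at x) \<and> w x = (1 / \<epsilon>' x) * u' \<and>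
              (w has_vector_derivative w') (at x) \<and> - (1 / of_real \<mu>) * w' = \<omega>\<^sup>2 * u x)"
    using assms unfolding solution_def by blast
  have "(u has_vector_derivative \<epsilon>' x * w x) (at x) \<and> (w has_vector_derivative - k * u x) (at x)"
    if x: "isCont \<epsilon>' x" "\<epsilon>' x \<noteq> 0" for x
  proof -
    obtain u' w' where *: "(u has_vector_derivative u') (at x)" "w x = (1 / \<epsilon>' x) * u'"
      "(w has_vector_derivative w') (at x)" "- (1 / of_real \<mu>) * w' = \<omega>\<^sup>2 * u x"
      using der x(1) by blast
    have "u' = \<epsilon>' x * w x" using *(2) x(2) by simp
    moreover have "w' = - of_real \<mu> * (- (1 / of_real \<mu>) * w')" using \<mu>_pos by simp
    then have "w' = - k * u x" unfolding *(4) by (simp add: k_def)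
    ultimately show ?thesis using *(1,3) by simp
  qed
  with u w show ?thesis by (intro that[of w]) simp_all
qed

text \<open>The direction from left to right is the substantial one: the system asks for the
  equation also at nodes where the value of \<open>\<epsilon>\<close> differs from its limit, and
  the continuation lemma supplies it.\<close>

lemma solution_iff: "solution \<mu> \<epsilon> \<omega> u \<longleftrightarrow> (\<exists>w. system_solution k e u w)"
proof
  assume "solution \<mu> \<epsilon> \<omega> u"
  then obtain w where w: "continuous_on UNIV u" "continuous_on UNIV w"
    "\<forall>x. isCont \<epsilon> x \<longrightarrow> \<epsilon> x \<noteq> 0 \<longrightarrow>
      (u has_vector_derivative \<epsilon> x * w x) (at x) \<and> (w has_vector_derivative - k * u x) (at x)"
    by (rule solution_fluxE)
  have der: "(u has_vector_derivative \<epsilon> x * w x) (at x) \<and> (w has_vector_derivative - k * u x) (at x)"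
    if "isCont \<epsilon> x" for x
    using w(3) that \<epsilon>_nz by simp
  obtain v z where vz: "system_solution k e v z" and vu: "\<forall>x\<in>UNIV. v x = u x \<and> z x = w x"
    by (rule system_solution_extension[OF is_interval_univ UNIV_I w(1,2) der])
  have "v = u" using vu by auto
  with vz show "\<exists>w. system_solution k e u w" by blast
next
  assume "\<exists>w. system_solution k e u w"
  then obtain w where w: "system_solution k e u w" ..
  have "(u has_vector_derivative e x * w x) (at x) \<and> w x = (1 / \<epsilon> x) * (e x * w x) \<and>
      (w has_vector_derivative - k * u x) (at x) \<and> - (1 / of_real \<mu>) * (- k * u x) = \<omega>\<^sup>2 * u x"
    if "isCont \<epsilon> x" for x
    using system_solution_derivatives[OF w that] isCont_\<epsilon>D[OF that] \<epsilon>_nz[of x] \<mu>_pos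
    by (simp add: k_def)
  then show "solution \<mu> \<epsilon> \<omega> u"
    using w unfolding solution_def system_solution_def by blast
qed

section \<open>Cauchy data and the transfer matrix\<close>

lemma system_solution_node_derivative:
  assumes "system_solution k e u w"
  shows "(u has_vector_derivative \<epsilon>_node * w (x0 + of_int n)) (at (x0 + of_int n))"
  using assms isCont_e_node[of n] e_node[of n] unfolding system_solution_def by metis

lemma cauchy_data_eq:
  assumes "system_solution k e u w"
  shows "cauchy_data x0 u n = vector [u (x0 + of_int n), \<epsilon>_node * w (x0 + of_int n)]"
  using vector_derivative_at[OF system_solution_node_derivative[OF assms]]
  by (simp add: cauchy_data_def)

text \<open>The propagator of field and flux over one cell, conjugated by the diagonal matrix with
  entries \<open>1\<close> and \<open>\<epsilon>_node\<close>, which converts flux into derivative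
  at a node.\<close>

definition cell_matrix ::
    "(real \<Rightarrow> complex) \<Rightarrow> (real \<Rightarrow> complex) \<Rightarrow> (real \<Rightarrow> complex) \<Rightarrow> (real \<Rightarrow> complex) \<Rightarrow> complex^2^2" where
  "cell_matrix \<theta> \<eta> \<phi> \<psi> =
     vector [vector [\<theta> (x0 + 1), \<phi> (x0 + 1) / \<epsilon>_node],
             vector [\<epsilon>_node * \<eta> (x0 + 1), \<psi> (x0 + 1)]]"

text \<open>Shifting a solution by whole periods gives a solution, so every cell reduces to the one
  that starts at \<open>x0\<close>.\<close>

lemma transfer_matrix_eq:
  assumes F: "fundamental \<theta> \<eta> \<phi> \<psi>"
  shows "transfer_matrix \<mu> x0 \<epsilon> \<omega> = cell_matrix \<theta> \<eta> \<phi> \<psi>"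
    and "solution \<mu> \<epsilon> \<omega> u \<Longrightarrow>
      cauchy_data x0 u (n + 1) = cell_matrix \<theta> \<eta> \<phi> \<psi> *v cauchy_data x0 u n"
proof -
  let ?T = "cell_matrix \<theta> \<eta> \<phi> \<psi>"
  have step0: "cauchy_data x0 u 1 = ?T *v cauchy_data x0 u 0" if uw: "system_solution k e u w" for u w
  proof -
    have der: "(u has_vector_derivative \<epsilon> x * w x) (at x) \<and> (w has_vector_derivative - k * u x) (at x)"
      if "isCont \<epsilon> x" for x
      using uw that by (rule system_solution_derivatives)
    have cont: "continuous_on UNIV u" "continuous_on UNIV w"
      using uw by (simp_all add: system_solution_def)
    have "u (x0 + 1) = u x0 * \<theta> (x0 + 1) + w x0 * \<phi> (x0 + 1)"
      "w (x0 + 1) = u x0 * \<eta> (x0 + 1) + w x0 * \<psi> (x0 + 1)"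
      by (rule fundamental_representation[OF F is_interval_univ _ _ cont der]; simp)+
    then show ?thesis
      using \<epsilon>_node(2)
      by (simp add: cauchy_data_eq[OF uw] cell_matrix_def matrix_vector_mult_2 algebra_simps)
  qed
  have step: "cauchy_data x0 u (n + 1) = ?T *v cauchy_data x0 u n"
    if sol: "solution \<mu> \<epsilon> \<omega> u" for u n
  proof -
    obtain w where "system_solution k e u w" using sol solution_iff by blast
    from step0[OF system_solution_shift[OF this, of n]] show ?thesis
      by (simp add: cauchy_data_shift add.commute)
  qed
  then show "solution \<mu> \<epsilon> \<omega> u \<Longrightarrow> cauchy_data x0 u (n + 1) = ?T *v cauchy_data x0 u n" .
  show "transfer_matrix \<mu> x0 \<epsilon> \<omega> = ?T"
    unfolding transfer_matrix_def
  proof (rule the_equality)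
    show "\<forall>u. solution \<mu> \<epsilon> \<omega> u \<longrightarrow> (\<forall>n. cauchy_data x0 u (n + 1) = ?T *v cauchy_data x0 u n)"
      using step by blast
    fix T assume T: "\<forall>u. solution \<mu> \<epsilon> \<omega> u \<longrightarrow> (\<forall>n. cauchy_data x0 u (n + 1) = T *v cauchy_data x0 u n)"
    have eq: "T *v cauchy_data x0 u 0 = ?T *v cauchy_data x0 u 0" if "system_solution k e u w" for u w
    proof -
      have "solution \<mu> \<epsilon> \<omega> u" using that solution_iff by blast
      with T step show ?thesis by metis
    qed
    have \<theta>: "system_solution k e \<theta> \<eta>" "\<theta> x0 = 1" "\<eta> x0 = 0"
      and \<phi>: "system_solution k e \<phi> \<psi>" "\<phi> x0 = 0" "\<psi> x0 = 1"
      using F by (simp_all add: fundamental_def)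
    \<comment> \<open>The two fundamental solutions have data \<open>(1, 0)\<close> and
      \<open>(0, \<epsilon>_node)\<close> at \<open>x0\<close>, a basis on which the matrices
      agree.\<close>
    show "T = ?T"
      using eq[OF \<theta>(1)] eq[OF \<phi>(1)] \<epsilon>_node(2) \<theta> \<phi>
      by (simp add: cauchy_data_eq[OF \<theta>(1)] cauchy_data_eq[OF \<phi>(1)] cell_matrix_def matrix_vector_mult_2
          vec_eq_iff forall_2 field_simps)
  qed
qed

lemma cauchy_data_step:
  assumes "solution \<mu> \<epsilon> \<omega> u"
  shows "cauchy_data x0 u (n + 1) = transfer_matrix \<mu> x0 \<epsilon> \<omega> *v cauchy_data x0 u n"
proof -
  obtain \<theta> \<eta> \<phi> \<psi> where "fundamental \<theta> \<eta> \<phi> \<psi>" by (rule fundamental_exists)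
  then show ?thesis using transfer_matrix_eq assms by metis
qed

lemma det_transfer_matrix: "det (transfer_matrix \<mu> x0 \<epsilon> \<omega>) = 1"
proof -
  obtain \<theta> \<eta> \<phi> \<psi> where F: "fundamental \<theta> \<eta> \<phi> \<psi>" by (rule fundamental_exists)
  then have \<theta>: "system_solution k e \<theta> \<eta>" and \<phi>: "system_solution k e \<phi> \<psi>"
    by (simp_all add: fundamental_def)
  have "\<theta> (x0 + 1) * \<psi> (x0 + 1) - \<eta> (x0 + 1) * \<phi> (x0 + 1) = \<theta> x0 * \<psi> x0 - \<eta> x0 * \<phi> x0"
    by (rule wronskian_eq[OF _ finite_K, where e = \<epsilon> and k = k])
      (use \<theta> \<phi> system_solution_derivatives[OF \<theta>] system_solution_derivatives[OF \<phi>] in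
        \<open>auto simp: K_def system_solution_def intro: continuous_on_subset\<close>)
  then show ?thesis
    using F \<epsilon>_node(2)
    by (simp add: transfer_matrix_eq(1)[OF F] cell_matrix_def det_2 fundamental_def field_simps)
qed

section \<open>Eigenvalues in a band gap and decay along a half-line\<close>

lemma band_gap_eigenvalue:
  assumes gap: "in_band_gap \<mu> \<epsilon> \<omega>" and ev: "eigenvalue (transfer_matrix \<mu> x0 \<epsilon> \<omega>) t"
  shows "norm t \<noteq> 1"
proof
  assume t: "norm t = 1"
  let ?T = "transfer_matrix \<mu> x0 \<epsilon> \<omega>"
  obtain y where y: "y \<noteq> 0" "?T *v y = t *s y" using ev by (auto simp: eigenvalue_def)
  \<comment> \<open>The eigenvector serves as Cauchy data; its second entry is a derivative, so the
    flux is obtained by dividing by \<open>\<epsilon>_node\<close>.\<close>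
  obtain v z where vz: "system_solution k e v z" "v x0 = y $ 1" "z x0 = y $ 2 / \<epsilon>_node"
    by (rule system_solution_exists[OF integrable_e])
  have sol: "solution \<mu> \<epsilon> \<omega> v" using vz solution_iff by blast
  have data0: "cauchy_data x0 v 0 = y"
    using vz \<epsilon>_node(2) by (simp add: cauchy_data_eq[OF vz(1)] vec_eq_iff forall_2)
  have "cauchy_data x0 v 1 = t *s y"
    using cauchy_data_step[OF sol, of 0] by (simp add: data0 y)
  then have "v (x0 + 1) = t * v x0" "\<epsilon>_node * z (x0 + 1) = \<epsilon>_node * (t * z x0)"
    using vz \<epsilon>_node(2) by (simp_all add: cauchy_data_eq[OF vz(1)] vec_eq_iff forall_2)
  then have data1: "v (x0 + 1) = t * v x0" "z (x0 + 1) = t * z x0"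
    using \<epsilon>_node(2) by simp_all
  obtain \<theta> \<eta> \<phi> \<psi> where F: "fundamental \<theta> \<eta> \<phi> \<psi>" by (rule fundamental_exists)
  have rep: "p x = p x0 * \<theta> x + q x0 * \<phi> x" if pq: "system_solution k e p q" for p q x
    by (rule fundamental_representation[OF F is_interval_univ])
      (use pq system_solution_derivatives[OF pq] in \<open>auto simp: system_solution_def\<close>)
  \<comment> \<open>The translate of \<open>v\<close> and the multiple \<open>t * v\<close> both
    solve the system with the same field and flux at \<open>x0\<close>, so they coincide.\<close>
  have bloch: "v (x + 1) = t * v x" for x
    using rep[OF system_solution_shift[OF vz(1), of 1], of x] rep[OF vz(1), of x] data1
    by (simp add: algebra_simps)
  have bloch': "(v has_vector_derivative t * d) (at (x + 1))"
    if d: "(v has_vector_derivative d) (at x)" for x d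
  proof -
    have "((\<lambda>y. v (y + - 1)) has_vector_derivative d) (at (x + 1))"
      unfolding has_vector_derivative_translate_iff using d by simp
    then have "((\<lambda>y. v (y - 1)) has_vector_derivative d) (at (x + 1))" by simp
    then have "((\<lambda>y. t * v (y - 1)) has_vector_derivative t * d) (at (x + 1))"
      by (rule has_vector_derivative_mult_right)
    moreover have "t * v (y - 1) = v y" for y using bloch[of "y - 1"] by simp
    ultimately show ?thesis by simp
  qed
  have t0: "t \<noteq> 0" using t by auto
  \<comment> \<open>As \<open>t\<close> has modulus one, its argument is the quasimomentum
    \<open>\<kappa>\<close>.\<close>
  have "exp (\<i> * of_real (Arg t)) = t"
    using t cis_Arg[OF t0] by (simp add: cis_conv_exp sgn_eq)
  moreover have "Arg t \<in> {- pi..pi}" using Arg_bounded[of t] by auto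
  moreover have "\<exists>x. v x \<noteq> 0"
  proof (rule ccontr)
    assume "\<nexists>x. v x \<noteq> 0"
    then have "v = (\<lambda>_. 0)" by auto
    then have "cauchy_data x0 v 0 = 0" by (simp add: cauchy_data_def vec_eq_iff forall_2)
    with data0 y show False by simp
  qed
  ultimately show False
    using gap sol bloch bloch' unfolding in_band_gap_def by metis
qed

lemma lambda1_eigenvalue:
  assumes gap: "in_band_gap \<mu> \<epsilon> \<omega>"
  defines "T \<equiv> transfer_matrix \<mu> x0 \<epsilon> \<omega>" and "q \<equiv> lambda1 \<mu> x0 \<epsilon> \<omega>"
  shows "q \<noteq> 0" and "norm q < 1" and "T $ 1 $ 1 + T $ 2 $ 2 = q + 1 / q"
proof -
  obtain r where r: "r \<noteq> 0" "norm r < 1" "T $ 1 $ 1 + T $ 2 $ 2 = r + 1 / r"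
    "\<And>t. eigenvalue T t \<and> norm t < 1 \<longleftrightarrow> t = r"
    using unimodular_contracting_eigenvalue[OF det_transfer_matrix band_gap_eigenvalue[OF gap]]
    unfolding T_def by blast
  have "q = r" unfolding q_def lambda1_def T_def[symmetric] r(4) by simp
  with r show "q \<noteq> 0" "norm q < 1" "T $ 1 $ 1 + T $ 2 $ 2 = q + 1 / q" by simp_all
qed

text \<open>By Cayley--Hamilton and \<open>det T = 1\<close>, each component of the Cauchy data satisfies a
  three-term recurrence that is symmetric under reversal of \<open>n\<close>; this treats both half-lines.\<close>

lemma decaying_cauchy_data:
  assumes gap: "in_band_gap \<mu> \<epsilon> \<omega>" and v: "solution \<mu> \<epsilon> \<omega> v" and s: "s = 1 \<or> s = - 1"
    and lim: "(\<lambda>n. cauchy_data x0 v (s * int n) $ i) \<longlonglongrightarrow> 0"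
  shows "cauchy_data x0 v (s * int n) $ i = lambda1 \<mu> x0 \<epsilon> \<omega> ^ n * cauchy_data x0 v 0 $ i"
proof -
  define c where "c n = cauchy_data x0 v n $ i" for n
  let ?q = "lambda1 \<mu> x0 \<epsilon> \<omega>" and ?T = "transfer_matrix \<mu> x0 \<epsilon> \<omega>"
  have rec: "c (n + 2) = (?q + 1 / ?q) * c (n + 1) - c n" for n
  proof -
    let ?y = "cauchy_data x0 v n"
    have det: "?T $ 1 $ 1 * ?T $ 2 $ 2 = 1 + ?T $ 1 $ 2 * ?T $ 2 $ 1"
      using det_transfer_matrix by (simp add: det_2 algebra_simps)
    have 1: "cauchy_data x0 v (n + 1) = ?T *v ?y"
      by (rule cauchy_data_step[OF v])
    have 2: "cauchy_data x0 v (n + 2) = ?T *v (?T *v ?y)"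
      using cauchy_data_step[OF v, of "n + 1"] by (simp add: 1 add.assoc)
    have "?T *v (?T *v ?y) = (?T $ 1 $ 1 + ?T $ 2 $ 2) *s (?T *v ?y) - ?y"
      using arg_cong[OF det, of "\<lambda>z. z * ?y $ 1"] arg_cong[OF det, of "\<lambda>z. z * ?y $ 2"]
      by (simp add: matrix_vector_mult_2 vec_eq_iff forall_2 algebra_simps)
    then show ?thesis
      by (simp add: c_def 1 2 lambda1_eigenvalue(3)[OF gap] distrib_right)
  qed
  have "c (s * int (Suc (Suc n))) = (?q + 1 / ?q) * c (s * int (Suc n)) - c (s * int n)" for n
    using s
  proof
    assume "s = 1"
    then show ?thesis using rec[of "int n"] by (simp add: add.commute)
  next
    assume "s = - 1"
    \<comment> \<open>This instance involves the indices \<open>- n\<close>, \<open>- n - 1\<close>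
      and \<open>- n - 2\<close>; solved for the last one it is the same recurrence run
      backwards.\<close>
    then show ?thesis using rec[of "- int n - 2"] by (simp add: algebra_simps)
  qed
  from decaying_solution_of_recurrence[where c = "\<lambda>n. c (s * int n)", OF this
      lambda1_eigenvalue(1,2)[OF gap]] lim
  show ?thesis by (simp add: c_def)
qed

text \<open>The sign \<open>s\<close> selects the half-line. There \<open>u\<close> agrees with a
  global solution \<open>v\<close> of the periodic medium, and every node with \<open>0 < n\<close>
  is interior, so \<open>u\<close> and \<open>v\<close> have the same derivative at it. The node
  \<open>n = 0\<close> is the interface, where \<open>u\<close> may fail to be
  differentiable.\<close>

lemma half_line_decay:
  assumes gap: "in_band_gap \<mu> \<epsilon> \<omega>" and mode: "localised_eigenmode \<mu> \<epsilon>' \<omega> u"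
    and s: "s = 1 \<or> s = - 1"
    and agree: "\<And>x. 0 < of_int s * (x - x0) \<Longrightarrow> \<epsilon>' x = \<epsilon> x"
  obtains C where
    "\<And>n. 0 < n \<Longrightarrow> norm (u (x0 + of_int (s * int n))) \<le> C * norm (lambda1 \<mu> x0 \<epsilon> \<omega>) ^ n"
    "\<And>n. 0 < n \<Longrightarrow> norm (vector_derivative u (at (x0 + of_int (s * int n))))
      \<le> C * norm (lambda1 \<mu> x0 \<epsilon> \<omega>) ^ n"
proof -
  define S where "S = {x. 0 \<le> of_int s * (x - x0)}"
  define U where "U = {x. 0 < of_int s * (x - x0)}"
  have "S = {x0..} \<and> U = {x0<..} \<or> S = {..x0} \<and> U = {..<x0}"
    using s by (auto simp: S_def U_def)
  then have S: "is_interval S" "x0 \<in> S" and U: "open U" "interior S = U" "U \<subseteq> S"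
    by (auto simp: is_interval_ci is_interval_ic)
  have node: "x0 + of_int (s * int n) \<in> U" if "0 < n" for n
    using that s by (auto simp: U_def)
  have "solution \<mu> \<epsilon>' \<omega> u" using mode by (simp add: localised_eigenmode_def)
  then obtain w where w: "continuous_on UNIV u" "continuous_on UNIV w"
    "\<forall>x. isCont \<epsilon>' x \<longrightarrow> \<epsilon>' x \<noteq> 0 \<longrightarrow>
      (u has_vector_derivative \<epsilon>' x * w x) (at x) \<and> (w has_vector_derivative - k * u x) (at x)"
    by (rule solution_fluxE)
  have der: "(u has_vector_derivative \<epsilon> x * w x) (at x) \<and> (w has_vector_derivative - k * u x) (at x)"
    if "x \<in> interior S" "isCont \<epsilon> x" for x
  proof -
    have x: "x \<in> U" using that U by simp
    \<comment> \<open>The equation for \<open>u\<close> is available where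
      \<open>\<epsilon>'\<close> is continuous; equality with \<open>\<epsilon>\<close> on the open
      set \<open>U\<close> transfers continuity.\<close>
    have "eventually (\<lambda>y. \<epsilon>' y = \<epsilon> y) (nhds x)"
      using U(1) x agree by (auto simp: eventually_nhds U_def)
    then have "isCont \<epsilon>' x" using that(2) isCont_cong by blast
    moreover have "\<epsilon>' x = \<epsilon> x" using x agree by (simp add: U_def)
    ultimately show ?thesis using w(3)[rule_format, of x] \<epsilon>_nz[of x] by simp
  qed
  obtain v z where vz: "system_solution k e v z" and vu: "\<forall>x\<in>S. v x = u x \<and> z x = w x"
    by (rule system_solution_extension[OF S continuous_on_subset[OF w(1) subset_UNIV]
          continuous_on_subset[OF w(2) subset_UNIV] der])
  have sol: "solution \<mu> \<epsilon> \<omega> v" using vz solution_iff by blast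
  have u_der: "(u has_vector_derivative cauchy_data x0 v (s * int n) $ 2) (at (x0 + of_int (s * int n)))"
    if "0 < n" for n
  proof -
    have "(v has_vector_derivative cauchy_data x0 v (s * int n) $ 2) (at (x0 + of_int (s * int n)))"
      using system_solution_node_derivative[OF vz, of "s * int n"] by (simp add: cauchy_data_eq[OF vz])
    then show ?thesis
      by (rule has_vector_derivative_transform_within_open[OF _ U(1) node[OF that]])
        (use vu U(3) in auto)
  qed
  have u_eq: "u (x0 + of_int (s * int n)) = cauchy_data x0 v (s * int n) $ 1" if "0 < n" for n
    using node[OF that] vu U(3) by (auto simp: cauchy_data_def)
  obtain C a where a: "a > 0"
    and ev: "\<forall>\<^sub>F x in at_infinity. norm (u x) \<le> C * exp (- a * \<bar>x\<bar>) \<and>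
           (\<forall>d. (u has_vector_derivative d) (at x) \<longrightarrow> norm d \<le> C * exp (- a * \<bar>x\<bar>))"
    using mode unfolding localised_eigenmode_def by blast
  let ?x = "\<lambda>n. x0 + of_int (s * int n)"
  have abs_x: "filterlim (\<lambda>n. \<bar>?x n\<bar>) at_top sequentially"
  proof (rule filterlim_at_top_mono)
    show "filterlim (\<lambda>n. - \<bar>x0\<bar> + real n) at_top sequentially"
      by (intro filterlim_tendsto_add_at_top[OF tendsto_const] filterlim_real_sequentially)
    show "\<forall>\<^sub>F n in sequentially. - \<bar>x0\<bar> + real n \<le> \<bar>?x n\<bar>"
      using s by (intro always_eventually) auto
  qed
  then have "filterlim ?x at_infinity sequentially"
    by (intro filterlim_norm_at_top_imp_at_infinity) simp
  from eventually_compose_filterlim[OF ev this]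
  have bound: "\<forall>\<^sub>F n in sequentially. norm (cauchy_data x0 v (s * int n) $ i) \<le> C * exp (- a * \<bar>?x n\<bar>)" for i
    using eventually_gt_at_top[of 0]
  proof eventually_elim
    case (elim n)
    then show ?case using u_der[of n] u_eq[of n] exhaust_2[of i] by auto
  qed
  have "filterlim (\<lambda>n. - a * \<bar>?x n\<bar>) at_bot sequentially"
    using filterlim_tendsto_neg_mult_at_bot[OF tendsto_const, of "- a"] a abs_x by simp
  then have "(\<lambda>n. C * exp (- a * \<bar>?x n\<bar>)) \<longlonglongrightarrow> C * 0"
    by (intro tendsto_mult tendsto_const filterlim_compose[OF exp_at_bot])
  then have lim: "(\<lambda>n. cauchy_data x0 v (s * int n) $ i) \<longlonglongrightarrow> 0" for i
    using Lim_null_comparison[OF bound] by simp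
  \<comment> \<open>The constant comes from the data of \<open>v\<close> at \<open>x0\<close>: by
    \<open>decaying_cauchy_data\<close> each component is an exact power of the eigenvalue times its
    value there.\<close>
  define B where "B = norm (cauchy_data x0 v 0)"
  have decay: "norm (cauchy_data x0 v (s * int n) $ i) \<le> B * norm (lambda1 \<mu> x0 \<epsilon> \<omega>) ^ n" for n i
    unfolding decaying_cauchy_data[OF gap sol s lim] B_def norm_mult norm_power
    by (subst mult.commute, rule mult_right_mono[OF Finite_Cartesian_Product.norm_nth_le]) simp
  show ?thesis
  proof (rule that[of B])
    fix n :: nat assume n: "0 < n"
    show "norm (u (?x n)) \<le> B * norm (lambda1 \<mu> x0 \<epsilon> \<omega>) ^ n"
      unfolding u_eq[OF n] by (rule decay)
    show "norm (vector_derivative u (at (?x n))) \<le> B * norm (lambda1 \<mu> x0 \<epsilon> \<omega>) ^ n"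
      unfolding vector_derivative_at[OF u_der[OF n]] by (rule decay)
  qed
qed

end

theorem corollary7p4:
  fixes \<mu>\<^sub>0 x\<^sub>0 :: real and \<epsilon>A \<epsilon>B u :: "real \<Rightarrow> complex" and \<omega> :: complex
  assumes "\<mu>\<^sub>0 > 0"
    and "permittivity x\<^sub>0 \<epsilon>A" and "permittivity x\<^sub>0 \<epsilon>B"
    and "localised_eigenmode \<mu>\<^sub>0 (interface x\<^sub>0 \<epsilon>A \<epsilon>B) \<omega> u"
    and "in_band_gap \<mu>\<^sub>0 \<epsilon>A \<omega>" and "in_band_gap \<mu>\<^sub>0 \<epsilon>B \<omega>"
  shows "((\<lambda>n::int. u (x\<^sub>0 + of_int n))
           \<in> O[at_bot](\<lambda>n. of_real (norm (lambda1 \<mu>\<^sub>0 x\<^sub>0 \<epsilon>A \<omega>) ^ nat \<bar>n\<bar>))) \<and>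
         ((\<lambda>n::int. vector_derivative u (at (x\<^sub>0 + of_int n)))
           \<in> O[at_bot](\<lambda>n. of_real (norm (lambda1 \<mu>\<^sub>0 x\<^sub>0 \<epsilon>A \<omega>) ^ nat \<bar>n\<bar>))) \<and>
         ((\<lambda>n::int. u (x\<^sub>0 + of_int n))
           \<in> O[at_top](\<lambda>n. of_real (norm (lambda1 \<mu>\<^sub>0 x\<^sub>0 \<epsilon>B \<omega>) ^ nat \<bar>n\<bar>))) \<and>
         ((\<lambda>n::int. vector_derivative u (at (x\<^sub>0 + of_int n)))
           \<in> O[at_top](\<lambda>n. of_real (norm (lambda1 \<mu>\<^sub>0 x\<^sub>0 \<epsilon>B \<omega>) ^ nat \<bar>n\<bar>)))"
proof -
  interpret A: symmetric_medium \<mu>\<^sub>0 x\<^sub>0 \<epsilon>A \<omega> by unfold_locales (use assms in auto)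
  interpret B: symmetric_medium \<mu>\<^sub>0 x\<^sub>0 \<epsilon>B \<omega> by unfold_locales (use assms in auto)
  \<comment> \<open>The half-line bounds start one node away from the interface, hence the passage
    to \<open>n \<le> - 1\<close> here and to \<open>1 \<le> n\<close> in
    \<open>top\<close>.\<close>
  have bot: "f \<in> O[at_bot](\<lambda>n. of_real (q ^ nat \<bar>n\<bar>))"
    if "\<And>n. 0 < n \<Longrightarrow> norm (f (- 1 * int n)) \<le> C * q ^ n" "0 \<le> q" for f :: "int \<Rightarrow> complex" and q C
  proof (rule bigoI)
    show "\<forall>\<^sub>F n in at_bot. norm (f n) \<le> C * norm (of_real (q ^ nat \<bar>n\<bar>) :: complex)"
      using eventually_le_at_bot[of "- 1"]
    proof eventually_elim
      case (elim n)
      then show ?case using that(1)[of "nat \<bar>n\<bar>"] that(2) by (simp add: norm_power)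
    qed
  qed
  have top: "f \<in> O[at_top](\<lambda>n. of_real (q ^ nat \<bar>n\<bar>))"
    if "\<And>n. 0 < n \<Longrightarrow> norm (f (1 * int n)) \<le> C * q ^ n" "0 \<le> q" for f :: "int \<Rightarrow> complex" and q C
  proof (rule bigoI)
    show "\<forall>\<^sub>F n in at_top. norm (f n) \<le> C * norm (of_real (q ^ nat \<bar>n\<bar>) :: complex)"
      using eventually_ge_at_top[of 1]
    proof eventually_elim
      case (elim n)
      then show ?case using that(1)[of "nat \<bar>n\<bar>"] that(2) by (simp add: norm_power)
    qed
  qed
  have left: "interface x\<^sub>0 \<epsilon>A \<epsilon>B x = \<epsilon>A x" if "0 < of_int (- 1) * (x - x\<^sub>0)" for x
    using that by (simp add: interface_def)
  have right: "interface x\<^sub>0 \<epsilon>A \<epsilon>B x = \<epsilon>B x" if "0 < of_int 1 * (x - x\<^sub>0)" for x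
    using that by (simp add: interface_def)
  obtain CA where CA:
    "\<And>n. 0 < n \<Longrightarrow> norm (u (x\<^sub>0 + of_int (- 1 * int n))) \<le> CA * norm (lambda1 \<mu>\<^sub>0 x\<^sub>0 \<epsilon>A \<omega>) ^ n"
    "\<And>n. 0 < n \<Longrightarrow> norm (vector_derivative u (at (x\<^sub>0 + of_int (- 1 * int n))))
      \<le> CA * norm (lambda1 \<mu>\<^sub>0 x\<^sub>0 \<epsilon>A \<omega>) ^ n"
    using A.half_line_decay[OF assms(5,4) _ left] by blast
  obtain CB where CB:
    "\<And>n. 0 < n \<Longrightarrow> norm (u (x\<^sub>0 + of_int (1 * int n))) \<le> CB * norm (lambda1 \<mu>\<^sub>0 x\<^sub>0 \<epsilon>B \<omega>) ^ n"
    "\<And>n. 0 < n \<Longrightarrow> norm (vector_derivative u (at (x\<^sub>0 + of_int (1 * int n))))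
      \<le> CB * norm (lambda1 \<mu>\<^sub>0 x\<^sub>0 \<epsilon>B \<omega>) ^ n"
    using B.half_line_decay[OF assms(6,4) _ right] by blast
  show ?thesis
    using bot[OF CA(1)] bot[OF CA(2)] top[OF CB(1)] top[OF CB(2)] by simp
qed

end
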